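(* Let $P,Q$ be lattice paths from $(0,0)$ to $(m,r)$ with $P$ never going above $Q$ such that $M[P,Q]$ is connected. Then the bounding paths are determined by the matroid up to a $180^\circ$ rotation: if $P^*,Q^*$ are lattice paths (with $P^*$ never above $Q^*$) such that $M[P^*,Q^*]$ is isomorphic to $M[P,Q]$, then $(P^*,Q^* )$ is either $(P,Q)$ or $(Q^\rho,P^\rho)$, where for a word $s_1s_2\cdots s_{m+r}$ in $\{E,N\}$ we set $(s_1s_2\cdots s_{m+r})^\rho=s_{m+r}\cdots s_2s_1$.
   Context: Lattice paths start at $(0,0)$ and use steps $E=(1,0)$ and $N=(0,1)$, and are written as words in $\{E,N\}$. For lattice paths $P,Q$ from $(0,0)$ to $(m,r)$ with $P$ never going above $Q$, let $\mathcal{P}$ be the set of lattice paths from $(0,0)$ to $(m,r)$ going neither above $Q$ nor below $P$, and for $1\le i\le r$ let $N_i=\{j:\text{step } j \text{ is the } i\text{-th North step of some path in }\mathcal{P}\}$. The matroid $M[P,Q]$ is the transversal matroid on $[m+r]=\{1,\ldots,m+r\}$ with presentation $(N_1,\ldots,N_r)$ (its independent sets are the partial transversals of this set system). *)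

theory Defs
  imports Main
begin

section \<open>Matroids given by their independent sets\<close>

text \<open>The record only carries the data of a matroid; the axioms are not part of the type. Every
  instance used below is a transversal matroid.\<close>

record 'a matroid =
  ground :: "'a set"
  indep_sets :: "'a set set"

definition circuit :: "'a matroid \<Rightarrow> 'a set \<Rightarrow> bool" where
  "circuit M C \<longleftrightarrow>
     C \<subseteq> ground M \<and> C \<notin> indep_sets M \<and> (\<forall>D. D \<subset> C \<longrightarrow> D \<in> indep_sets M)"

text \<open>Connectedness as in Oxley: any two distinct elements lie in a common circuit. In
  particular matroids with at most one element are connected.\<close>

definition matroid_connected :: "'a matroid \<Rightarrow> bool" where
  "matroid_connected M \<longleftrightarrow>
     (\<forall>x\<in>ground M. \<forall>y\<in>ground M. x \<noteq> y \<longrightarrow> (\<exists>C. circuit M C \<and> x \<in> C \<and> y \<in> C))"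

definition matroid_isomorphic :: "'a matroid \<Rightarrow> 'b matroid \<Rightarrow> bool" where
  "matroid_isomorphic M M' \<longleftrightarrow>
     (\<exists>f. bij_betw f (ground M) (ground M') \<and>
          (\<forall>X. X \<subseteq> ground M \<longrightarrow> (X \<in> indep_sets M \<longleftrightarrow> f ` X \<in> indep_sets M')))"

definition partial_transversal :: "'i set \<Rightarrow> ('i \<Rightarrow> 'a set) \<Rightarrow> 'a set \<Rightarrow> bool" where
  "partial_transversal I A X \<longleftrightarrow>
     (\<exists>\<phi>. inj_on \<phi> X \<and> \<phi> ` X \<subseteq> I \<and> (\<forall>x\<in>X. x \<in> A (\<phi> x)))"

definition transversal_matroid :: "'a set \<Rightarrow> 'i set \<Rightarrow> ('i \<Rightarrow> 'a set) \<Rightarrow> 'a matroid" where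
  "transversal_matroid S I A =
     \<lparr>ground = S, indep_sets = {X. X \<subseteq> S \<and> partial_transversal I A X}\<rparr>"

section \<open>Lattice paths\<close>

datatype lattice_step = East | North

definition lattice_paths :: "nat \<Rightarrow> nat \<Rightarrow> lattice_step list set" where
  "lattice_paths m r = {w. count_list w East = m \<and> count_list w North = r}"

text \<open>Paths with the same endpoints are compared along the antidiagonals: after \<open>k\<close> steps both
  are on the line \<open>x + y = k\<close>, and the one with fewer North steps is the lower one. The
  definition is meant only for paths with the same endpoints.\<close>

definition never_above :: "lattice_step list \<Rightarrow> lattice_step list \<Rightarrow> bool" where
  "never_above P Q \<longleftrightarrow> (\<forall>k. count_list (take k P) North \<le> count_list (take k Q) North)"

definition paths_between ::
  "nat \<Rightarrow> nat \<Rightarrow> lattice_step list \<Rightarrow> lattice_step list \<Rightarrow> lattice_step list set" where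
  "paths_between m r P Q = {R \<in> lattice_paths m r. never_above R Q \<and> never_above P R}"

text \<open>Steps are numbered from 1, so step \<open>j\<close> of \<open>R\<close> is \<open>R ! (j - 1)\<close>.\<close>

definition is_ith_north_step :: "lattice_step list \<Rightarrow> nat \<Rightarrow> nat \<Rightarrow> bool" where
  "is_ith_north_step R i j \<longleftrightarrow>
     1 \<le> j \<and> j \<le> length R \<and> R ! (j - 1) = North \<and> count_list (take j R) North = i"

definition north_set ::
  "nat \<Rightarrow> nat \<Rightarrow> lattice_step list \<Rightarrow> lattice_step list \<Rightarrow> nat \<Rightarrow> nat set" where
  "north_set m r P Q i = {j. \<exists>R\<in>paths_between m r P Q. is_ith_north_step R i j}"

definition lattice_path_matroid ::
  "nat \<Rightarrow> nat \<Rightarrow> lattice_step list \<Rightarrow> lattice_step list \<Rightarrow> nat matroid" where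
  "lattice_path_matroid m r P Q = transversal_matroid {1..m + r} {1..r} (north_set m r P Q)"

end

theory Submission
  imports Defs
begin

text \<open>A path is encoded by its height function \<open>h\<close>, where \<open>h k\<close> is the number of North steps
  among the first \<open>k\<close> steps; the bases of \<open>M[P,Q]\<close> are the sets of North steps of the paths in the
  band between \<open>P\<close> and \<open>Q\<close>. Call \<open>F\<close> with \<open>2 \<le> |F| \<le> n - 2\<close> a flacet if the only sets \<open>A\<close> that
  meet all bases maximizing \<open>|B \<inter> F|\<close> in equally many elements are the trivial ones, namely \<open>\<emptyset>\<close>,
  \<open>F\<close>, its complement and the ground set. For connected \<open>M[P,Q]\<close>
  these are exactly the initial segments ending at the EN corners of \<open>Q\<close> and the final segments
  starting at the NE corners of \<open>P\<close>. Indeed, if \<open>F\<close> is a flacet and exactly one of \<open>j\<close>, \<open>j + 1\<close>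
  is in \<open>F\<close>, then all extremal paths have the same height at \<open>j\<close>: otherwise a sum of three of them
  could be pushed at \<open>j\<close> in the profitable direction and, being still three times a fractional
  path, split again into three paths, one of which would beat the maximum. So \<open>{1..j}\<close> meets the
  extremal bases in equally many elements and must be \<open>F\<close> or its complement. Initial flacets are
  pairwise comparable, so are final ones, and an initial one is never comparable with a final one;
  hence an isomorphism preserves or exchanges the two families. Finally, a path is determined by
  the positions and heights of its EN corners, which are the sizes and ranks of the flacets.\<close>

section \<open>Height functions\<close>

definition steps :: "nat \<Rightarrow> (nat \<Rightarrow> int) \<Rightarrow> bool" where
  "steps n h \<longleftrightarrow> h 0 = 0 \<and> (\<forall>k<n. h k \<le> h (Suc k) \<and> h (Suc k) \<le> h k + 1)"

definition band :: "nat \<Rightarrow> (nat \<Rightarrow> int) \<Rightarrow> (nat \<Rightarrow> int) \<Rightarrow> (nat \<Rightarrow> int) set" where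
  "band n p q = {h. steps n h \<and> (\<forall>k\<le>n. p k \<le> h k \<and> h k \<le> q k)}"

definition ups :: "nat \<Rightarrow> (nat \<Rightarrow> int) \<Rightarrow> nat set" where
  "ups n h = {j \<in> {1..n}. h (j - 1) < h j}"

text \<open>For a path this counts the North steps at positions in \<open>A\<close>. Being linear in
  \<open>h\<close>, it also makes sense for sums of paths and for perturbations that are not
  paths.\<close>

definition weight :: "nat set \<Rightarrow> (nat \<Rightarrow> int) \<Rightarrow> int" where
  "weight A h = (\<Sum>i\<in>A. h i - h (i - 1))"

text \<open>An EN corner: step \<open>u\<close> is East and step \<open>Suc u\<close> is
  North.\<close>

definition corner :: "nat \<Rightarrow> (nat \<Rightarrow> int) \<Rightarrow> nat \<Rightarrow> bool" where
  "corner n h u \<longleftrightarrow> 0 < u \<and> u < n \<and> h (u - 1) = h u \<and> h (Suc u) = h u + 1"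

text \<open>The height function of the reversed word. It turns NE corners into EN corners, so one
  notion of corner serves both bounding paths.\<close>

definition reversed :: "nat \<Rightarrow> (nat \<Rightarrow> int) \<Rightarrow> nat \<Rightarrow> int" where
  "reversed n h k = h n - h (n - k)"

lemma steps_pred:
  assumes "steps n h" "j \<in> {1..n}"
  shows "h (j - 1) \<le> h j" "h j \<le> h (j - 1) + 1"
  using assms by (cases j; auto simp: steps_def)+

lemma steps_between:
  assumes h: "steps n h" and "i \<le> k" "k \<le> n"
  shows "h i \<le> h k" "h k \<le> h i + int (k - i)"
proof -
  have "h i \<le> h k \<and> h k \<le> h i + int (k - i)"
    using assms(2,3)
  proof (induction k rule: dec_induct)
    case (step k)
    then have "h k \<le> h (Suc k)" "h (Suc k) \<le> h k + 1"
      using h by (auto simp: steps_def)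
    with step show ?case by (auto simp: Suc_diff_le)
  qed auto
  then show "h i \<le> h k" "h k \<le> h i + int (k - i)" by auto
qed

lemma card_ups_Int:
  assumes h: "steps n h" and A: "A \<subseteq> {1..n}"
  shows "int (card (ups n h \<inter> A)) = weight A h"
proof -
  have fin: "finite A" using A finite_subset by blast
  have "weight A h = (\<Sum>i\<in>A. if i \<in> ups n h then 1 else 0)"
    unfolding weight_def
  proof (rule sum.cong)
    fix i assume "i \<in> A"
    then have "i \<in> {1..n}" using A by auto
    then show "h i - h (i - 1) = (if i \<in> ups n h then 1 else 0)"
      using steps_pred[OF h, of i] by (auto simp: ups_def)
  qed auto
  also have "\<dots> = int (card (A \<inter> ups n h))"
    using fin by (simp add: sum.If_cases Int_def)
  finally show ?thesis by (simp add: Int_commute)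
qed

lemma weight_segment: "weight {Suc i..k} h = h k - h i" if "i \<le> k"
  using that
proof (induction k rule: dec_induct)
  case base
  then show ?case by (simp add: weight_def)
next
  case (step k)
  have "{Suc i..Suc k} = insert (Suc k) {Suc i..k}" using step by auto
  then show ?case using step by (simp add: weight_def)
qed

lemma weight_add: "weight A (\<lambda>k. g k + h k) = weight A g + weight A h"
  by (simp add: weight_def sum.distrib[symmetric] algebra_simps)

text \<open>The bump raises the increment at \<open>j\<close> by \<open>e\<close> and lowers the one
  at \<open>Suc j\<close> by \<open>e\<close>.\<close>

lemma weight_bump:
  assumes "A \<subseteq> {1..n}" "0 < j"
  shows "weight A (\<lambda>k. if k = j then e else 0) = e * (of_bool (j \<in> A) - of_bool (Suc j \<in> A))"
proof -
  have "weight A (\<lambda>k. if k = j then e else 0)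
      = (\<Sum>i\<in>A. (if i = j then e else 0) - (if i = Suc j then e else 0))"
    unfolding weight_def
  proof (rule sum.cong)
    fix i assume "i \<in> A"
    then have "i \<noteq> 0" using assms by auto
    then show "(if i = j then e else 0) - (if i - 1 = j then e else 0)
      = ((if i = j then e else 0) - (if i = Suc j then e else 0))"
      by auto
  qed auto
  also have "\<dots> = e * (of_bool (j \<in> A) - of_bool (Suc j \<in> A))"
    using finite_subset[OF assms(1)] by (simp add: sum_subtractf)
  finally show ?thesis .
qed

text \<open>Clamping a staircase with its only up-step at \<open>j\<close>, respectively at \<open>j + 1\<close>, between
  \<open>lo\<close> and \<open>hi\<close> gives two members of the band that differ only at \<open>j\<close>.\<close>

lemma band_flip:
  assumes lo: "steps n lo" and hi: "steps n hi" and le: "\<And>k. k \<le> n \<Longrightarrow> lo k \<le> hi k"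
    and j: "0 < j" "j < n" and lt: "lo j < hi j"
  obtains g g' where "g \<in> band n lo hi" "g' \<in> band n lo hi"
    "g' = (\<lambda>k. g k + (if k = j then 1 else 0))"
proof -
  define c where "c = lo j"
  define clamp where "clamp f k = max (lo k) (min (hi k) (f k))" for f :: "nat \<Rightarrow> int" and k
  define f where "f k = (if k \<le> j then c else c + 1)" for k
  define f' where "f' k = (if k < j then c else c + 1)" for k
  have c0: "lo k \<le> hi k \<and> lo k \<le> clamp F k \<and> clamp F k \<le> hi k" if "k \<le> n" for F k
    using le[OF that] by (auto simp: clamp_def)
  have clamp_band: "clamp F \<in> band n lo hi"
    if F: "\<And>k. k < n \<Longrightarrow> F k \<le> F (Suc k) \<and> F (Suc k) \<le> F k + 1" for F
  proof -
    have "clamp F k \<le> clamp F (Suc k) \<and> clamp F (Suc k) \<le> clamp F k + 1" if "k < n" for k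
    proof -
      have "lo k \<le> lo (Suc k)" "lo (Suc k) \<le> lo k + 1" "hi k \<le> hi (Suc k)" "hi (Suc k) \<le> hi k + 1"
        using lo hi that by (auto simp: steps_def)
      then show ?thesis using F[OF that] unfolding clamp_def by linarith
    qed
    moreover have "clamp F 0 = 0"
      using lo hi by (auto simp: clamp_def steps_def)
    ultimately show ?thesis using c0 by (auto simp: band_def steps_def)
  qed
  \<comment> \<open>The staircases differ only at \<open>j\<close>, with values \<open>c\<close> and
    \<open>c + 1\<close>; both survive clamping because \<open>lo j = c < hi j\<close>.\<close>
  have "clamp f' k = clamp f k + (if k = j then 1 else 0)" for k
    using lt by (cases "k = j") (auto simp: clamp_def f_def f'_def c_def)
  then have "clamp f' = (\<lambda>k. clamp f k + (if k = j then 1 else 0))" by auto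
  moreover have "clamp f \<in> band n lo hi" by (rule clamp_band) (auto simp: f_def)
  moreover have "clamp f' \<in> band n lo hi" by (rule clamp_band) (auto simp: f'_def)
  ultimately show thesis using that by blast
qed

text \<open>Two band members that differ by a bump at \<open>j\<close> have equal weight only if
  \<open>A\<close> does not separate \<open>j\<close> from \<open>Suc j\<close>.\<close>

lemma band_constant_weight:
  assumes "steps n lo" "steps n hi" "\<And>k. k \<le> n \<Longrightarrow> lo k \<le> hi k"
    and j: "0 < j" "j < n" and "lo j < hi j" and A: "A \<subseteq> {1..n}"
    and const: "\<And>g h. g \<in> band n lo hi \<Longrightarrow> h \<in> band n lo hi \<Longrightarrow> weight A g = weight A h"
  shows "j \<in> A \<longleftrightarrow> Suc j \<in> A"
proof -
  obtain g g' where g: "g \<in> band n lo hi" "g' \<in> band n lo hi"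
    "g' = (\<lambda>k. g k + (if k = j then 1 else 0))"
    using band_flip[OF assms(1-6)] by blast
  have "weight A (\<lambda>k. if k = j then 1 else 0) = 0"
    using const[OF g(1,2)] by (simp add: g(3) weight_add)
  then show ?thesis
    using weight_bump[OF A j(1), of 1] by (auto split: if_splits simp: of_bool_def)
qed

text \<open>The three functions \<open>(H + s) div 3\<close> sum to \<open>H\<close> and inherit the constraints from \<open>H\<close>.\<close>

lemma split_three:
  assumes H0: "H 0 = 0"
    and H: "\<And>k. k < n \<Longrightarrow> H k \<le> H (Suc k) \<and> H (Suc k) \<le> H k + 3"
    and bound: "\<And>k. k \<le> n \<Longrightarrow> 3 * p k \<le> H k \<and> H k \<le> 3 * q k"
  obtains g0 g1 g2 where "g0 \<in> band n p q" "g1 \<in> band n p q" "g2 \<in> band n p q"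
    "H = (\<lambda>k. (g0 k + g1 k) + g2 k)"
proof -
  define g where "g s k = (H k + s) div 3" for s k
  have mem: "g s \<in> band n p q" if "s \<in> {0, 1, 2}" for s
  proof -
    have "g s k \<le> g s (Suc k) \<and> g s (Suc k) \<le> g s k + 1" if "k < n" for k
    proof -
      have "(H k + s) div 3 \<le> (H (Suc k) + s) div 3" "(H (Suc k) + s) div 3 \<le> (H k + s + 3) div 3"
        using H[OF that] by (intro zdiv_mono1; simp)+
      then show ?thesis by (simp add: g_def)
    qed
    moreover have "p k \<le> g s k \<and> g s k \<le> q k" if "k \<le> n" for k
      using bound[OF that] \<open>s \<in> _\<close> unfolding g_def by auto
    moreover have "g s 0 = 0" using H0 \<open>s \<in> _\<close> by (auto simp: g_def)
    ultimately show ?thesis by (auto simp: band_def steps_def)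
  qed
  \<comment> \<open>Hermite's identity for one third of \<open>H k\<close>, checked on the three
    residues.\<close>
  have "H k = (g 0 k + g 1 k) + g 2 k" for k
  proof -
    define y z where "y = H k div 3" and "z = H k mod 3"
    have "H k = 3 * y + z" "z \<in> {0, 1, 2}" unfolding y_def z_def by auto
    then show ?thesis by (auto simp: g_def)
  qed
  then show thesis using that[of "g 0" "g 1" "g 2"] mem by auto
qed

section \<open>Reconstruction of a path from its EN corners\<close>

text \<open>From \<open>k\<close>, go back along North steps to \<open>u\<close> and forward along
  East steps to \<open>v\<close>. Unless \<open>u = 0\<close> or \<open>v = n\<close>, step
  \<open>u\<close> is East and step \<open>Suc v\<close> is North; then \<open>u\<close> is a corner
  if \<open>u < k\<close>, and \<open>v\<close> is one if \<open>u = k\<close>.\<close>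

lemma corner_anchor:
  assumes h: "steps n h" and k: "k \<le> n"
  obtains u where "u = 0 \<or> u = n \<or> corner n h u" "u \<le> k" "h k = h u + int (k - u)"
  | u where "u = 0 \<or> u = n \<or> corner n h u" "k \<le> u" "u \<le> n" "h k = h u"
proof -
  define u where "u = (LEAST u. u \<le> k \<and> h k = h u + int (k - u))"
  have u: "u \<le> k" "h k = h u + int (k - u)"
    using LeastI[of "\<lambda>u. u \<le> k \<and> h k = h u + int (k - u)" k] unfolding u_def by auto
  have u_least: "u \<le> i" if "i \<le> k" "h k = h i + int (k - i)" for i
    using Least_le[of "\<lambda>u. u \<le> k \<and> h k = h u + int (k - u)" i] that unfolding u_def by auto
  define v where "v = (GREATEST v. v \<le> n \<and> h k = h v)"
  have v: "v \<le> n" "h k = h v"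
    using GreatestI_nat[of "\<lambda>v. v \<le> n \<and> h k = h v" k n] k unfolding v_def by auto
  have v_greatest: "i \<le> v" if "i \<le> n" "h k = h i" for i
    using Greatest_le_nat[of "\<lambda>v. v \<le> n \<and> h k = h v" i n] that unfolding v_def by auto
  have kv: "k \<le> v" using v_greatest k by auto
  consider "u = 0" | "v = n" | "0 < u" "v < n" using v by linarith
  then show thesis
  proof cases
    case 3
    have flat: "h (u - 1) = h u"
    proof -
      have "h k \<noteq> h (u - 1) + int (k - (u - 1))"
        using u_least[of "u - 1"] u 3 by force
      then show ?thesis using steps_pred[OF h, of u] u k 3 by (auto simp: of_nat_diff)
    qed
    have up: "h (Suc v) = h v + 1"
    proof -
      have "h k \<noteq> h (Suc v)" using v_greatest[of "Suc v"] 3 by force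
      then show ?thesis using h 3 v unfolding steps_def by force
    qed
    show thesis
    proof (cases "u < k")
      case True
      have "h k \<le> h (Suc u) + int (k - Suc u)"
        using steps_between[OF h, of "Suc u" k] True k by auto
      moreover have "h (Suc u) \<le> h u + 1" using h True k by (auto simp: steps_def)
      ultimately have "h (Suc u) = h u + 1" using u(2) True by (simp add: of_nat_diff)
      then have "corner n h u" using flat 3 True k by (auto simp: corner_def)
      then show thesis using that(1) u by blast
    next
      case False
      then have uk: "u = k" using u by auto
      have "h (v - 1) = h v"
      proof (cases "v = k")
        case False
        then have "h k \<le> h (v - 1)" using kv v by (intro steps_between[OF h]) auto
        then show ?thesis using steps_pred[OF h, of v] v False kv by auto
      qed (use flat uk in auto)
      then have "corner n h v" using up 3 kv uk by (auto simp: corner_def)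
      then show thesis using that(2) v kv by blast
    qed
  qed (use that u v kv in blast)+
qed

text \<open>A path is the highest one through its endpoints and EN corners: from an anchor before
  \<open>k\<close> it climbs at every step, and to an anchor after \<open>k\<close> it stays level,
  so \<open>g\<close> cannot get above it.\<close>

lemma corners_determine_le:
  assumes h: "steps n h" and g: "steps n g" and "g n \<le> h n"
    and sub: "\<And>u. corner n h u \<Longrightarrow> g u \<le> h u" and k: "k \<le> n"
  shows "g k \<le> h k"
proof -
  have le: "g u \<le> h u" if "u = 0 \<or> u = n \<or> corner n h u" for u
    using that assms by (auto simp: steps_def)
  show ?thesis
  proof (rule corner_anchor[OF h k])
    fix u assume u: "u = 0 \<or> u = n \<or> corner n h u" "u \<le> k" "h k = h u + int (k - u)"
    then show ?thesis using le[of u] steps_between[OF g, of u k] k by auto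
  next
    fix u assume u: "u = 0 \<or> u = n \<or> corner n h u" "k \<le> u" "u \<le> n" "h k = h u"
    then show ?thesis using le[of u] steps_between[OF g, of k u] by auto
  qed
qed

definition corner_data :: "nat \<Rightarrow> (nat \<Rightarrow> int) \<Rightarrow> (nat \<times> int) set" where
  "corner_data n h = {(u, h u) | u. corner n h u}"

lemma corner_data_determines:
  assumes "steps n h" "steps n g" "g n = h n" "corner_data n g = corner_data n h" "k \<le> n"
  shows "g k = h k"
proof -
  have eq: "g u = h u" if "corner n g u \<or> corner n h u" for u
  proof -
    have "(u, g u) \<in> corner_data n h \<or> (u, h u) \<in> corner_data n g"
      using that assms(4) by (auto simp: corner_data_def)
    then show ?thesis by (auto simp: corner_data_def)
  qed
  show ?thesis
    using corners_determine_le[OF assms(1,2) _ _ assms(5)]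
      corners_determine_le[OF assms(2,1) _ _ assms(5)] assms(3) eq
    by (intro antisym) auto
qed

lemma steps_reversed: "steps n h \<Longrightarrow> steps n (reversed n h)"
  unfolding steps_def reversed_def
proof (safe)
  fix k assume h: "\<forall>k<n. h k \<le> h (Suc k) \<and> h (Suc k) \<le> h k + 1" and k: "k < n"
  have *: "n - k = Suc (n - Suc k)" "n - Suc k < n" using k by auto
  show "h n - h (n - k) \<le> h n - h (n - Suc k)" using h * by auto
  show "h n - h (n - Suc k) \<le> h n - h (n - k) + 1" using h * by fastforce
qed auto


section \<open>Rigid sets of a band\<close>

locale path_band =
  fixes n :: nat and p q :: "nat \<Rightarrow> int"
  assumes p_steps: "steps n p" and q_steps: "steps n q"
    and p_le_q: "\<And>k. k \<le> n \<Longrightarrow> p k \<le> q k" and ends: "p n = q n"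
begin

definition extremal :: "nat set \<Rightarrow> (nat \<Rightarrow> int) set" where
  "extremal F = {h \<in> band n p q. \<forall>g\<in>band n p q. weight F g \<le> weight F h}"

text \<open>The flacet condition in terms of paths; words and matroids stay out of the combinatorial
  argument.\<close>

definition rigid :: "nat set \<Rightarrow> bool" where
  "rigid F \<longleftrightarrow> F \<subseteq> {1..n} \<and> 2 \<le> card F \<and> 2 \<le> card ({1..n} - F) \<and>
     (\<forall>A\<subseteq>{1..n}. (\<forall>g\<in>extremal F. \<forall>h\<in>extremal F. weight A g = weight A h)
        \<longrightarrow> A \<in> {{}, F, {1..n} - F, {1..n}})"

lemma bandD:
  assumes "h \<in> band n p q"
  shows "steps n h" "h 0 = 0" "h n = q n" "\<And>k. k \<le> n \<Longrightarrow> p k \<le> h k" "\<And>k. k \<le> n \<Longrightarrow> h k \<le> q k"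
    "\<And>k. k < n \<Longrightarrow> h k \<le> h (Suc k)" "\<And>k. k < n \<Longrightarrow> h (Suc k) \<le> h k + 1"
  using assms ends by (auto simp: band_def steps_def intro: antisym)

lemma p_in_band: "p \<in> band n p q" and q_in_band: "q \<in> band n p q"
  using p_steps q_steps p_le_q by (auto simp: band_def)

section \<open>Exchange argument for extremal paths\<close>

text \<open>\<open>S\<close> has three times the maximal weight. The hypotheses \<open>H\<close> are
  the tripled path constraints that a bump at \<open>j\<close> can violate; if they hold, the bumped
  sum splits into three band members, none above the maximum, so the bump gains nothing.\<close>

lemma extremal_bump:
  assumes F: "F \<subseteq> {1..n}" and a: "a \<in> extremal F" "b \<in> extremal F" "c \<in> extremal F"
    and j: "0 < j" "j < n" and S: "S = (\<lambda>k. (a k + b k) + c k)"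
    and H: "S (j - 1) \<le> S j + e" "S j + e \<le> S (j - 1) + 3"
      "S j + e \<le> S (Suc j)" "S (Suc j) \<le> S j + e + 3" "3 * p j \<le> S j + e" "S j + e \<le> 3 * q j"
  shows "e * (of_bool (j \<in> F) - of_bool (Suc j \<in> F)) \<le> 0"
proof -
  define H where "H k = S k + (if k = j then e else 0)" for k
  have abc: "a \<in> band n p q" "b \<in> band n p q" "c \<in> band n p q" using a by (auto simp: extremal_def)
  have S_step: "S k \<le> S (Suc k) \<and> S (Suc k) \<le> S k + 3" if "k < n" for k
    using abc[THEN bandD(6), OF that] abc[THEN bandD(7), OF that] unfolding S by linarith
  have "H 0 = 0" using abc[THEN bandD(2)] j by (simp add: H_def S)
  moreover have "H k \<le> H (Suc k) \<and> H (Suc k) \<le> H k + 3" if "k < n" for k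
    using S_step[OF that] H by (auto simp: H_def)
  moreover have "3 * p k \<le> H k \<and> H k \<le> 3 * q k" if "k \<le> n" for k
    using abc[THEN bandD(4), OF that] abc[THEN bandD(5), OF that] H(5,6)
    by (cases "k = j") (auto simp: H_def S)
  ultimately obtain g0 g1 g2 where g: "g0 \<in> band n p q" "g1 \<in> band n p q" "g2 \<in> band n p q"
    "H = (\<lambda>k. (g0 k + g1 k) + g2 k)"
    by (rule split_three)
  have "weight F H = weight F a + weight F b + weight F c
      + e * (of_bool (j \<in> F) - of_bool (Suc j \<in> F))"
    unfolding H_def[abs_def] S by (simp only: weight_add weight_bump[OF F j(1)])
  moreover have "weight F H = weight F g0 + weight F g1 + weight F g2"
    unfolding g(4) by (simp only: weight_add)
  \<comment> \<open>All of \<open>a\<close>, \<open>b\<close>, \<open>c\<close> attain the maximum,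
    so any pairing will do.\<close>
  moreover have "weight F g0 \<le> weight F a" "weight F g1 \<le> weight F b" "weight F g2 \<le> weight F c"
    using a g by (auto simp: extremal_def)
  ultimately show ?thesis by linarith
qed

text \<open>Otherwise there is room for a bump in the profitable direction: one extremal path gives
  slack in step \<open>j\<close>, one in step \<open>Suc j\<close>, and one in the height bound at
  \<open>j\<close>.\<close>

lemma extremal_boundary_constant:
  assumes F: "F \<subseteq> {1..n}" and j: "0 < j" "j < n" and bd: "j \<in> F \<longleftrightarrow> Suc j \<notin> F"
    and vary: "\<exists>g\<in>extremal F. \<exists>h\<in>extremal F. weight {j} g \<noteq> weight {j} h"
    and vary': "\<exists>g\<in>extremal F. \<exists>h\<in>extremal F. weight {Suc j} g \<noteq> weight {Suc j} h"
    and gh: "g \<in> extremal F" "h \<in> extremal F"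
  shows "g j = h j"
proof (rule ccontr)
  assume ne: "g j \<noteq> h j"
  have band: "f \<in> band n p q" if "f \<in> extremal F" for f using that by (auto simp: extremal_def)
  have step: "f (j - 1) \<le> f j \<and> f j \<le> f (j - 1) + 1 \<and> f j \<le> f (Suc j) \<and> f (Suc j) \<le> f j + 1
    \<and> p j \<le> f j \<and> f j \<le> q j" if "f \<in> extremal F" for f
    using bandD(4-7)[OF band[OF that], of j] steps_pred[OF bandD(1)[OF band[OF that]], of j] j by auto
  obtain a a' where a: "a \<in> extremal F" "a' \<in> extremal F" "weight {j} a < weight {j} a'"
    using vary by (metis linorder_neqE)
  obtain b b' where b: "b \<in> extremal F" "b' \<in> extremal F" "weight {Suc j} b < weight {Suc j} b'"
    using vary' by (metis linorder_neqE)
  obtain c c' where c: "c \<in> extremal F" "c' \<in> extremal F" "c j < c' j"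
    using gh ne by (metis linorder_neqE)
  note st = step[OF a(1)] step[OF a(2)] step[OF b(1)] step[OF b(2)] step[OF c(1)] step[OF c(2)]
  show False
  proof (cases "j \<in> F")
    case True
    \<comment> \<open>Raising: \<open>a\<close> is East at \<open>j\<close>, \<open>b'\<close> is
      North at \<open>Suc j\<close>, and \<open>c\<close> lies below \<open>q\<close> at
      \<open>j\<close>.\<close>
    have "1 * (of_bool (j \<in> F) - of_bool (Suc j \<in> F)) \<le> (0 :: int)"
      by (rule extremal_bump[OF F a(1) b(2) c(1) j refl]) (use st a(3) b(3) c(3) in \<open>auto simp: weight_def\<close>)
    then show False using True bd by auto
  next
    case False
    \<comment> \<open>Lowering: the opposite choices, with \<open>c'\<close> above \<open>p\<close>
      at \<open>j\<close>.\<close>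
    have "-1 * (of_bool (j \<in> F) - of_bool (Suc j \<in> F)) \<le> (0 :: int)"
      by (rule extremal_bump[OF F a(2) b(1) c(2) j refl]) (use st a(3) b(3) c(3) in \<open>auto simp: weight_def\<close>)
    then show False using False bd by auto
  qed
qed

section \<open>Extremal paths of initial and final segments\<close>

lemma weight_initial:
  assumes "h \<in> band n p q"
  shows "weight {Suc 0..u} h = h u"
  using weight_segment[of 0 u h] bandD(2)[OF assms] by simp

lemma weight_final:
  assumes "h \<in> band n p q" "j \<le> n"
  shows "weight {Suc j..n} h = q n - h j"
  using weight_segment[of j n h] assms bandD(3)[OF assms(1)] by simp

text \<open>The weight of \<open>{1..j}\<close> is the height at \<open>j\<close>, so extremal means
  touching \<open>q\<close> at \<open>j\<close>.\<close>

lemma extremal_initial: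
  assumes "j \<le> n"
  shows "q \<in> extremal {1..j}"
    and "h \<in> extremal {1..j} \<Longrightarrow> h j = q j"
    and "h \<in> band n p q \<Longrightarrow> h j = q j \<Longrightarrow> h \<in> extremal {1..j}"
proof -
  note le = bandD(5)[OF _ assms]
  show mem: "q \<in> extremal {1..j}"
    using q_in_band le assms by (simp add: extremal_def weight_initial)
  show "h j = q j" if "h \<in> extremal {1..j}"
  proof -
    have h: "h \<in> band n p q" "weight {1..j} q \<le> weight {1..j} h"
      using that mem by (auto simp: extremal_def)
    then show ?thesis using le[OF h(1)] q_in_band assms by (simp add: weight_initial)
  qed
  show "h \<in> extremal {1..j}" if "h \<in> band n p q" "h j = q j"
    using that le assms by (simp add: extremal_def weight_initial)
qed

text \<open>The weight is now \<open>q n - h j\<close>, so extremal means touching \<open>p\<close>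
  at \<open>j\<close>.\<close>

lemma extremal_final:
  assumes "j \<le> n"
  shows "p \<in> extremal {Suc j..n}"
    and "h \<in> extremal {Suc j..n} \<Longrightarrow> h j = p j"
    and "h \<in> band n p q \<Longrightarrow> h j = p j \<Longrightarrow> h \<in> extremal {Suc j..n}"
proof -
  note le = bandD(4)[OF _ assms]
  show mem: "p \<in> extremal {Suc j..n}"
    using p_in_band le assms by (simp add: extremal_def weight_final)
  show "h j = p j" if "h \<in> extremal {Suc j..n}"
  proof -
    have h: "h \<in> band n p q" "weight {Suc j..n} p \<le> weight {Suc j..n} h"
      using that mem by (auto simp: extremal_def)
    then show ?thesis using le[OF h(1)] p_in_band assms by (simp add: weight_final)
  qed
  show "h \<in> extremal {Suc j..n}" if "h \<in> band n p q" "h j = p j"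
    using that le assms by (simp add: extremal_def weight_final)
qed

section \<open>Rigid sets are corner segments\<close>

text \<open>Some \<open>j\<close> is separated from \<open>Suc j\<close> by \<open>F\<close>.
  Rigidity makes every single step vary over the extremal paths, hence their height at
  \<open>j\<close> is constant, hence \<open>{1..j}\<close> is \<open>F\<close> or its complement.
  Without a corner at \<open>j\<close>, step \<open>j\<close> or step \<open>Suc j\<close> would be
  frozen.\<close>

lemma rigid_is_corner_segment:
  assumes "rigid F"
  obtains u where "corner n q u" "F = {1..u}"
  | w where "corner n (reversed n p) w" "F = {Suc (n - w)..n}"
proof -
  have F: "F \<subseteq> {1..n}" "2 \<le> card F" "2 \<le> card ({1..n} - F)"
    and const: "\<And>A. A \<subseteq> {1..n} \<Longrightarrow> (\<forall>g\<in>extremal F. \<forall>h\<in>extremal F. weight A g = weight A h)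
        \<Longrightarrow> A \<in> {{}, F, {1..n} - F, {1..n}}"
    using assms unfolding rigid_def by blast+
  have "\<exists>j. 0 < j \<and> j < n \<and> (j \<in> F \<longleftrightarrow> Suc j \<notin> F)"
  proof (rule ccontr)
    assume "\<not> ?thesis"
    then have *: "j \<in> F \<longleftrightarrow> Suc j \<in> F" if "0 < j" "j < n" for j using that by blast
    have "j \<in> F \<longleftrightarrow> 1 \<in> F" if "1 \<le> j" "j \<le> n" for j
      using that by (induction j rule: dec_induct) (use * in auto)
    then have "F = {} \<or> F = {1..n}" using F(1) by (cases "1 \<in> F") auto
    then show False using F by auto
  qed
  then obtain j where j: "0 < j" "j < n" "j \<in> F \<longleftrightarrow> Suc j \<notin> F" by blast
  have jn: "j - Suc 0 \<le> n" "Suc j \<le> n" "Suc (j - Suc 0) = j" using j by auto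
  \<comment> \<open>The size bounds keep a singleton from being one of the four trivial
    sets.\<close>
  have vary: "\<exists>g\<in>extremal F. \<exists>h\<in>extremal F. weight {i} g \<noteq> weight {i} h" if "i \<in> {1..n}" for i
  proof (rule ccontr)
    assume "\<not> ?thesis"
    then have "\<forall>g\<in>extremal F. \<forall>h\<in>extremal F. weight {i} g = weight {i} h" by blast
    then have "{i} \<in> {{}, F, {1..n} - F, {1..n}}" by (intro const) (use that in simp)
    then have "card {i} \<in> card ` {{}, F, {1..n} - F, {1..n}}" by (rule imageI)
    moreover have "card F \<le> card {1..n}" using F(1) by (intro card_mono) auto
    ultimately show False using F(2,3) by auto
  qed
  have pinned: "g j = h j" if "g \<in> extremal F" "h \<in> extremal F" for g h
    by (rule extremal_boundary_constant[OF F(1) j(1,2,3) vary vary that]) (use j in auto)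
  have "weight {1..j} g = weight {1..j} h" if "g \<in> extremal F" "h \<in> extremal F" for g h
    using pinned[OF that] that by (simp add: extremal_def weight_initial)
  then have "\<forall>g\<in>extremal F. \<forall>h\<in>extremal F. weight {1..j} g = weight {1..j} h" by blast
  then have "{1..j} \<in> {{}, F, {1..n} - F, {1..n}}" by (intro const) (use j in simp)
  moreover have "{1..j} \<noteq> {1..n}" "{1..j} \<noteq> {}" using j by auto
  ultimately consider "F = {1..j}" | "{1..j} = {1..n} - F" by blast
  then show thesis
  proof cases
    case 1
    have hj: "h j = q j" and hb: "h \<in> band n p q" if "h \<in> extremal F" for h
      using extremal_initial(2)[of j h] j that by (auto simp: 1 extremal_def)
    have "q (j - 1) = q j"
    proof (rule ccontr)
      assume "q (j - 1) \<noteq> q j"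
      then have "q (j - 1) = q j - 1" using steps_pred[OF q_steps, of j] j by auto
      \<comment> \<open>\<open>h\<close> agrees with \<open>q\<close> at \<open>j\<close> and is at
        most \<open>q\<close> at \<open>j - 1\<close>, so it rises here as well.\<close>
      then have "weight {j} h = 1" if "h \<in> extremal F" for h
        using hj[OF that] bandD(5)[OF hb[OF that], of "j - 1"] steps_pred[OF bandD(1)[OF hb[OF that]], of j] j(1,2) jn
        by (simp add: weight_def)
      then show False using vary[of j] j(1,2) by auto
    qed
    moreover have "q (Suc j) = q j + 1"
    proof (rule ccontr)
      assume "q (Suc j) \<noteq> q j + 1"
      then have "q (Suc j) = q j" using q_steps j by (force simp: steps_def)
      then have "weight {Suc j} h = 0" if "h \<in> extremal F" for h
        using hj[OF that] bandD(5)[OF hb[OF that], of "Suc j"] bandD(6)[OF hb[OF that], of j] j(1,2) jn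
        by (simp add: weight_def)
      then show False using vary[of "Suc j"] j(1,2) by auto
    qed
    ultimately have "corner n q j" using j by (auto simp: corner_def)
    then show thesis using that(1) 1 by blast
  next
    case 2
    then have "F = {1..n} - {1..j}" using F(1) by blast
    then have Fj: "F = {Suc j..n}" by auto
    have hj: "h j = p j" and hb: "h \<in> band n p q" if "h \<in> extremal F" for h
      using extremal_final(2)[of j h] j that by (auto simp: Fj extremal_def)
    have "p (j - 1) = p j - 1"
    proof (rule ccontr)
      assume "p (j - 1) \<noteq> p j - 1"
      then have "p (j - 1) = p j" using steps_pred[OF p_steps, of j] j by auto
      then have "weight {j} h = 0" if "h \<in> extremal F" for h
        using hj[OF that] bandD(4)[OF hb[OF that], of "j - 1"] steps_pred[OF bandD(1)[OF hb[OF that]], of j] j(1,2) jn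
        by (simp add: weight_def)
      then show False using vary[of j] j(1,2) by auto
    qed
    moreover have "p (Suc j) = p j"
    proof (rule ccontr)
      assume "p (Suc j) \<noteq> p j"
      then have "p (Suc j) = p j + 1" using p_steps j by (force simp: steps_def)
      then have "weight {Suc j} h = 1" if "h \<in> extremal F" for h
        using hj[OF that] bandD(4)[OF hb[OF that], of "Suc j"] bandD(7)[OF hb[OF that], of j] j(1,2) jn
        by (simp add: weight_def)
      then show False using vary[of "Suc j"] j(1,2) by auto
    qed
    \<comment> \<open>The corner sits \<open>n - j\<close> steps from the end; these identities
      evaluate the truncated subtraction in \<open>reversed\<close>.\<close>
    moreover have "n - (n - j - 1) = Suc j" "n - Suc (n - j) = j - 1" "n - (n - j) = j" using j by auto
    ultimately have "corner n (reversed n p) (n - j)"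
      using j by (simp add: corner_def reversed_def)
    then show thesis using that(2)[of "n - j"] Fj j by simp
  qed
qed

section \<open>Corner segments are rigid\<close>

text \<open>A band of extremal paths that is pinched at most at \<open>v\<close> allows a bump at
  every other interior position, so \<open>A\<close> cannot split \<open>{1..v}\<close> or
  \<open>{Suc v..n}\<close>.\<close>

lemma constant_weight_two_blocks:
  assumes lo: "steps n lo" and hi: "steps n hi" and le: "\<And>k. k \<le> n \<Longrightarrow> lo k \<le> hi k"
    and v: "0 < v" "v < n" and lt: "\<And>k. 0 < k \<Longrightarrow> k < n \<Longrightarrow> k \<noteq> v \<Longrightarrow> lo k < hi k"
    and sub: "band n lo hi \<subseteq> extremal F" and A: "A \<subseteq> {1..n}"
    and const: "\<forall>g\<in>extremal F. \<forall>h\<in>extremal F. weight A g = weight A h"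
  shows "A \<in> {{}, {1..v}, {Suc v..n}, {1..n}}"
proof -
  have *: "j \<in> A \<longleftrightarrow> Suc j \<in> A" if "0 < j" "j < n" "j \<noteq> v" for j
    by (rule band_constant_weight[OF lo hi le that(1,2) lt[OF that] A]) (use const sub in auto)
  have low: "j \<in> A \<longleftrightarrow> 1 \<in> A" if "1 \<le> j" "j \<le> v" for j
    using that by (induction j rule: dec_induct) (use * v in auto)
  have high: "j \<in> A \<longleftrightarrow> Suc v \<in> A" if "Suc v \<le> j" "j \<le> n" for j
    using that by (induction j rule: dec_induct) (use * v in auto)
  have "{1..v} \<subseteq> A \<or> {1..v} \<inter> A = {}" "{Suc v..n} \<subseteq> A \<or> {Suc v..n} \<inter> A = {}"
    using low high by (meson atLeastAtMost_iff disjoint_iff subsetI)+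
  moreover have "{1..n} = {1..v} \<union> {Suc v..n}" using v by auto
  ultimately show ?thesis using A by (simp only: insert_iff) blast
qed

text \<open>Strict separation forces \<open>q\<close> to start with North and end with East, which
  keeps its EN corners away from both ends.\<close>

lemma corner_bounds:
  assumes lt: "\<And>k. 0 < k \<Longrightarrow> k < n \<Longrightarrow> p k < q k" and u: "corner n q u"
  shows "2 \<le> u" "u + 2 \<le> n"
proof -
  have u': "0 < u" "u < n" "q (u - 1) = q u" "q (Suc u) = q u + 1" using u by (auto simp: corner_def)
  have "p 0 = 0" "p 0 \<le> p 1" "q 0 = 0" using p_steps q_steps u' by (auto simp: steps_def)
  then have "q 0 \<noteq> q 1" using lt[of 1] u' by auto
  then show "2 \<le> u" using u' by (cases "u = 1") auto
  have "q (n - 1) = q n"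
    using lt[of "n - 1"] steps_pred[OF p_steps, of n] steps_pred[OF q_steps, of n] ends u' by auto
  then show "u + 2 \<le> n" using u' by (cases "Suc u = n") auto
qed

text \<open>The band between \<open>lo\<close> and \<open>q\<close> consists of paths through the
  corner, and the corner is its only interior pinch point.\<close>

lemma initial_corner_rigid:
  assumes lt: "\<And>k. 0 < k \<Longrightarrow> k < n \<Longrightarrow> p k < q k" and u: "corner n q u"
  shows "rigid {1..u}"
proof -
  have u': "0 < u" "u < n" "q (u - 1) = q u" "q (Suc u) = q u + 1" using u by (auto simp: corner_def)
  \<comment> \<open>The lowest path above \<open>p\<close> through the corner: it climbs at every
    step up to \<open>u\<close> and then stays level, unless \<open>p\<close> is higher.\<close>
  define lo where "lo k = max (p k) (q u + min 0 (int k - int u))" for k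
  have q0: "q 0 = 0" "p 0 = 0" using q_steps p_steps by (auto simp: steps_def)
  have lo: "steps n lo"
    unfolding steps_def
  proof (intro conjI allI impI)
    show "lo 0 = 0" using steps_between(2)[OF q_steps, of 0 u] u' q0 by (simp add: lo_def)
    fix k assume "k < n"
    then have "p k \<le> p (Suc k)" "p (Suc k) \<le> p k + 1" using p_steps by (auto simp: steps_def)
    then show "lo k \<le> lo (Suc k)" "lo (Suc k) \<le> lo k + 1" unfolding lo_def by linarith+
  qed
  \<comment> \<open>The East step \<open>u\<close> gives strictness before the corner, the North
    step \<open>Suc u\<close> after it.\<close>
  have up: "q u + min 0 (int k - int u) < q k" if "0 < k" "k < n" "k \<noteq> u" for k
  proof (cases "k < u")
    case True
    then have "k \<le> u - 1" "u - 1 \<le> n" "int (u - 1 - k) < int u - int k" using u' by auto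
    then show ?thesis using steps_between(2)[OF q_steps, of k "u - 1"] u'(3) True by linarith
  next
    case False
    then show ?thesis using steps_between(1)[OF q_steps, of "Suc u" k] u' that by auto
  qed
  have lt': "lo k < q k" if "0 < k" "k < n" "k \<noteq> u" for k
    using lt[OF that(1,2)] up[OF that] by (simp add: lo_def)
  have "lo u = q u" "lo n = q n" "lo 0 = q 0"
    using lt[of u] u' ends steps_between(1)[OF q_steps, of u n] steps_between(2)[OF q_steps, of 0 u] q0
    by (auto simp: lo_def)
  note lo_ends = this
  have le: "lo k \<le> q k" if "k \<le> n" for k
    using lt'[of k] lo_ends that by (cases "k = 0 \<or> k = n \<or> k = u") force+
  have "band n lo q \<subseteq> extremal {1..u}"
  proof
    fix h assume h: "h \<in> band n lo q"
    then have "h \<in> band n p q" by (auto simp: band_def lo_def)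
    moreover have "h u = q u" 
    proof -
      have "lo u \<le> h u" "h u \<le> q u" using h u'(2) by (simp_all add: band_def)
      then show ?thesis using lo_ends(1) by simp
    qed
    ultimately show "h \<in> extremal {1..u}" using u' by (intro extremal_initial(3)) auto
  qed
  note sub = this
  have compl: "{1..n} - {1..u} = {Suc u..n}" using u' by auto
  show ?thesis
    unfolding rigid_def compl
  proof (intro conjI allI impI)
    show "{1..u} \<subseteq> {1..n}" "2 \<le> card {1..u}" "2 \<le> card {Suc u..n}"
      using u' corner_bounds[OF lt u] by auto
    fix A assume "A \<subseteq> {1..n}" "\<forall>g\<in>extremal {1..u}. \<forall>h\<in>extremal {1..u}. weight A g = weight A h"
    then have "A \<in> {{}, {1..u}, {Suc u..n}, {1..n}}"
      by (intro constant_weight_two_blocks[OF lo q_steps _ u'(1,2) _ sub]) (assumption | erule le | erule (2) lt')+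
    then show "A \<in> {{}, {1..u}, {Suc u..n}, {1..n}}" by blast
  qed
qed

text \<open>Strict separation forces \<open>p\<close> to start with East and end with North.\<close>

lemma reversed_corner_bounds:
  assumes lt: "\<And>k. 0 < k \<Longrightarrow> k < n \<Longrightarrow> p k < q k"
    and v: "0 < v" "v < n" "p (v - 1) = p v - 1" "p (Suc v) = p v"
  shows "2 \<le> v" "v + 2 \<le> n"
proof -
  have "p 0 = 0" "q 0 = 0" "q 1 \<le> q 0 + 1" using p_steps q_steps v by (auto simp: steps_def)
  then have "p 1 \<noteq> p 0 + 1" using lt[of 1] v by auto
  then show "2 \<le> v" using v by (cases "v = 1") auto
  have "p (n - 1) \<noteq> p n"
    using lt[of "n - 1"] steps_pred[OF q_steps, of n] ends v by auto
  then show "v + 2 \<le> n" using v by (cases "Suc v = n") auto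
qed

lemma final_corner_rigid:
  assumes lt: "\<And>k. 0 < k \<Longrightarrow> k < n \<Longrightarrow> p k < q k" and w: "corner n (reversed n p) w"
  shows "rigid {Suc (n - w)..n}"
proof -
  define v where "v = n - w"
  \<comment> \<open>\<open>w\<close> counts from the end; at \<open>v\<close> the path
    \<open>p\<close> has a North step followed by an East step.\<close>
  have v: "0 < v" "v < n" "p (v - 1) = p v - 1" "p (Suc v) = p v"
    using w by (auto simp: corner_def reversed_def v_def Suc_diff_Suc Suc_diff_le)
  \<comment> \<open>The highest path below \<open>q\<close> through the corner: level before
    \<open>v\<close> and climbing after it, unless \<open>q\<close> is lower.\<close>
  define hi where "hi k = min (q k) (p v + max 0 (int k - int v))" for k
  have q0: "q 0 = 0" "p 0 = 0" using q_steps p_steps by (auto simp: steps_def)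
  have pv: "0 \<le> p v" "p n \<le> p v + int (n - v)"
    using steps_between(1)[OF p_steps, of 0 v] steps_between(2)[OF p_steps, of v n] v q0 by auto
  have hi: "steps n hi"
    unfolding steps_def
  proof (intro conjI allI impI)
    show "hi 0 = 0" using pv q0 by (simp add: hi_def)
    fix k assume "k < n"
    then have "q k \<le> q (Suc k)" "q (Suc k) \<le> q k + 1" using q_steps by (auto simp: steps_def)
    then show "hi k \<le> hi (Suc k)" "hi (Suc k) \<le> hi k + 1" unfolding hi_def by linarith+
  qed
  have up: "p k < p v + max 0 (int k - int v)" if "0 < k" "k < n" "k \<noteq> v" for k
  proof (cases "k < v")
    case True
    then have "k \<le> v - 1" "v - 1 \<le> n" using v by auto
    then show ?thesis using steps_between(1)[OF p_steps, of k "v - 1"] v(3) True by linarith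
  next
    case False
    then show ?thesis using steps_between(2)[OF p_steps, of "Suc v" k] v that by auto
  qed
  have lt': "p k < hi k" if "0 < k" "k < n" "k \<noteq> v" for k
    using lt[OF that(1,2)] up[OF that] by (simp add: hi_def)
  have hi_ends: "hi v = p v" "p n \<le> hi n" "p 0 \<le> hi 0"
    using lt[of v] v ends pv q0 by (auto simp: hi_def)
  have le: "p k \<le> hi k" if "k \<le> n" for k
    using lt'[of k] hi_ends that by (cases "k = 0 \<or> k = n \<or> k = v") force+
  have "band n p hi \<subseteq> extremal {Suc v..n}"
  proof
    fix h assume h: "h \<in> band n p hi"
    then have "h \<in> band n p q" by (auto simp: band_def hi_def)
    moreover have "h v = p v" 
    proof -
      have "p v \<le> h v" "h v \<le> hi v" using h v(2) by (simp_all add: band_def)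
      then show ?thesis using hi_ends(1) by simp
    qed
    ultimately show "h \<in> extremal {Suc v..n}" using v by (intro extremal_final(3)) auto
  qed
  note sub = this
  have compl: "{1..n} - {Suc v..n} = {1..v}" using v by auto
  show ?thesis
    unfolding rigid_def compl v_def[symmetric]
  proof (intro conjI allI impI)
    show "{Suc v..n} \<subseteq> {1..n}" "2 \<le> card {Suc v..n}" "2 \<le> card {1..v}"
      using v reversed_corner_bounds[OF lt v] by auto
    fix A assume "A \<subseteq> {1..n}" "\<forall>g\<in>extremal {Suc v..n}. \<forall>h\<in>extremal {Suc v..n}. weight A g = weight A h"
    then have "A \<in> {{}, {1..v}, {Suc v..n}, {1..n}}"
      by (intro constant_weight_two_blocks[OF p_steps hi _ v(1,2) _ sub]) (assumption | erule le | erule (2) lt')+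
    then show "A \<in> {{}, {Suc v..n}, {1..v}, {1..n}}" by blast
  qed
qed

end

section \<open>Lattice paths as height functions\<close>

definition height :: "lattice_step list \<Rightarrow> nat \<Rightarrow> int" where
  "height w k = int (count_list (take k w) North)"

lemma height_Suc:
  "height w (Suc k) = height w k + of_bool (k < length w \<and> w ! k = North)"
  by (cases "k < length w") (auto simp: height_def take_Suc_conv_app_nth)

lemma steps_height: "steps n (height w)"
  unfolding steps_def height_Suc by (simp add: height_def)

lemma length_eq_counts: "length w = count_list w East + count_list w North"
proof (induction w)
  case (Cons a w)
  then show ?case by (cases a) auto
qed simp

lemma lattice_path_length: "w \<in> lattice_paths m r \<Longrightarrow> length w = m + r"
  by (simp add: length_eq_counts lattice_paths_def)

lemma height_end: "w \<in> lattice_paths m r \<Longrightarrow> m + r \<le> k \<Longrightarrow> height w k = int r"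
  using lattice_path_length[of w m r] by (simp add: height_def lattice_paths_def)

lemma height_inject:
  assumes "length v = n" "length w = n" "\<And>k. k \<le> n \<Longrightarrow> height v k = height w k"
  shows "v = w"
proof (rule nth_equalityI)
  fix k assume k: "k < length v"
  have "of_bool (v ! k = North) = (of_bool (w ! k = North) :: int)"
    using assms(3)[of k] assms(3)[of "Suc k"] k assms(1,2) by (simp add: height_Suc)
  then have "v ! k = North \<longleftrightarrow> w ! k = North" by (simp split: if_splits add: of_bool_def)
  then show "v ! k = w ! k" by (metis (full_types) lattice_step.exhaust)
qed (use assms in simp)

lemma height_rev:
  assumes "length w = n" "k \<le> n"
  shows "height (rev w) k = reversed n (height w) k"
proof -
  have "count_list w North = count_list (take (n - k) w) North + count_list (drop (n - k) w) North"
    by (metis append_take_drop_id count_list_append)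
  moreover have "take k (rev w) = rev (drop (n - k) w)" using assms by (simp add: take_rev)
  ultimately show ?thesis using assms by (simp add: height_def reversed_def)
qed

lemma never_above_height:
  assumes "v \<in> lattice_paths m r" "w \<in> lattice_paths m r"
  shows "never_above v w \<longleftrightarrow> (\<forall>k\<le>m + r. height v k \<le> height w k)"
proof -
  have "height v k \<le> height w k" if "\<not> k \<le> m + r" for k
    using height_end[OF assms(1), of k] height_end[OF assms(2), of k] that by simp
  then show ?thesis unfolding never_above_def height_def by (metis of_nat_le_iff)
qed

lemma height_surj:
  assumes h: "steps (m + r) h" "h (m + r) = int r"
  obtains w where "w \<in> lattice_paths m r" "\<And>k. k \<le> m + r \<Longrightarrow> height w k = h k"
proof -
  define w where "w = map (\<lambda>k. if h k < h (Suc k) then North else East) [0..<m + r]"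
  have hw: "height w k = h k" if "k \<le> m + r" for k
    using that
  proof (induction k)
    case 0
    then show ?case using h by (simp add: height_def steps_def)
  next
    case (Suc k)
    then have "h k \<le> h (Suc k)" "h (Suc k) \<le> h k + 1" using h by (auto simp: steps_def)
    then show ?case using Suc by (auto simp: height_Suc w_def)
  qed
  have len: "length w = m + r" by (simp add: w_def)
  have "count_list w North = r" using hw[of "m + r"] h len by (simp add: height_def)
  then have "w \<in> lattice_paths m r" using len length_eq_counts[of w] by (simp add: lattice_paths_def)
  then show thesis using that hw by blast
qed

lemma is_ith_north_step_iff:
  assumes "length w = n"
  shows "is_ith_north_step w i j \<longleftrightarrow> j \<in> ups n (height w) \<and> height w j = int i"
proof (cases j)
  case (Suc k)
  then show ?thesis
    using assms height_Suc[of w k] by (auto simp: is_ith_north_step_def ups_def height_def)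
qed (auto simp: is_ith_north_step_def ups_def)

section \<open>Independent sets and bases of lattice path matroids\<close>

lemma ups_cong: "(\<And>k. k \<le> n \<Longrightarrow> g k = h k) \<Longrightarrow> ups n g = ups n h"
  unfolding ups_def by (rule Collect_cong) (metis atLeastAtMost_iff diff_le_self le_trans)

text \<open>Heights at North steps increase strictly, so they serve as distinct indices into the set
  system.\<close>

lemma ups_inj_on:
  assumes h: "steps n h"
  shows "inj_on h (ups n h)"
proof (rule linorder_inj_onI')
  fix i j assume ij: "i \<in> ups n h" "j \<in> ups n h" "i < j"
  then have "h i \<le> h (j - 1)" "h (j - 1) < h j"
    by (auto simp: ups_def intro!: steps_between(1)[OF h])
  then show "h i \<noteq> h j" by simp
qed

text \<open>The lowest path above \<open>p\<close> that rises at every element of \<open>X\<close>.\<close>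

primrec greedy :: "(nat \<Rightarrow> int) \<Rightarrow> nat set \<Rightarrow> nat \<Rightarrow> int" where
  "greedy p X 0 = 0"
| "greedy p X (Suc k) = max (greedy p X k + of_bool (Suc k \<in> X)) (p (Suc k))"

text \<open>Take for \<open>i\<close> the last position where the bound \<open>p\<close> was
  binding, or 0; after it only elements of \<open>X\<close> raise the path.\<close>

lemma greedy_attained:
  assumes "p 0 = 0"
  shows "\<exists>i\<le>k. greedy p X k = p i + int (card (X \<inter> {Suc i..k}))"
proof (induction k)
  case 0
  then show ?case using assms by simp
next
  case (Suc k)
  show ?case
  proof (cases "greedy p X k + of_bool (Suc k \<in> X) \<le> p (Suc k)")
    case True
    then show ?thesis by (intro exI[of _ "Suc k"]) (simp add: max_def)
  next
    case False
    from Suc obtain i where i: "i \<le> k" "greedy p X k = p i + int (card (X \<inter> {Suc i..k}))" by blast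
    have "X \<inter> {Suc i..Suc k} = (if Suc k \<in> X then insert (Suc k) (X \<inter> {Suc i..k}) else X \<inter> {Suc i..k})"
      using i by (auto simp: le_Suc_eq)
    then have "int (card (X \<inter> {Suc i..Suc k})) = int (card (X \<inter> {Suc i..k})) + of_bool (Suc k \<in> X)"
      by simp
    then show ?thesis using False i by (intro exI[of _ i]) auto
  qed
qed

text \<open>\<open>hall\<close> is Hall's condition on intervals: between \<open>i\<close> and
  \<open>k\<close> a band member can rise by at most \<open>q k - p i\<close>. It is what keeps the
  greedy path below \<open>q\<close>.\<close>

lemma greedy_band:
  assumes p: "steps n p" and q: "p n = q n"
    and hall: "\<And>i k. i \<le> k \<Longrightarrow> k \<le> n \<Longrightarrow> int (card (X \<inter> {Suc i..k})) \<le> q k - p i"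
    and X: "X \<subseteq> {1..n}"
  shows "greedy p X \<in> band n p q" "X \<subseteq> ups n (greedy p X)"
proof -
  have p0: "p 0 = 0" using p by (simp add: steps_def)
  have ge: "p k \<le> greedy p X k" for k
    by (cases k) (auto simp: p0)
  have step: "greedy p X k \<le> greedy p X (Suc k) \<and> greedy p X (Suc k) \<le> greedy p X k + 1"
    if "k < n" for k
  proof -
    have "p (Suc k) \<le> p k + 1" using p that by (simp add: steps_def)
    then show ?thesis using ge[of k] by auto
  qed
  have "greedy p X k \<le> q k" if "k \<le> n" for k
    using greedy_attained[of p k X, OF p0] hall that by fastforce
  then show "greedy p X \<in> band n p q"
    using ge step by (auto simp: band_def steps_def simp del: greedy.simps(2))
  show "X \<subseteq> ups n (greedy p X)"
  proof
    fix x assume x: "x \<in> X"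
    then obtain k where "x = Suc k" using X by (cases x) auto
    then show "x \<in> ups n (greedy p X)" using x X by (auto simp: ups_def)
  qed
qed

locale lattice_path_pair =
  fixes m r :: nat and P Q :: "lattice_step list"
  assumes P: "P \<in> lattice_paths m r" and Q: "Q \<in> lattice_paths m r" and PQ: "never_above P Q"
begin

abbreviation n :: nat where "n \<equiv> m + r"
abbreviation p :: "nat \<Rightarrow> int" where "p \<equiv> height P"
abbreviation q :: "nat \<Rightarrow> int" where "q \<equiv> height Q"
abbreviation M :: "nat matroid" where "M \<equiv> lattice_path_matroid m r P Q"

sublocale path_band n p q
  using never_above_height[OF P Q] PQ height_end[OF P, of n] height_end[OF Q, of n]
  by unfold_locales (auto simp: steps_height)

lemma q_end: "q n = int r" using height_end[OF Q, of n] by simp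

lemma north_set_iff:
  "j \<in> north_set m r P Q i \<longleftrightarrow> (\<exists>h\<in>band n p q. j \<in> ups n h \<and> h j = int i)"
proof
  assume "j \<in> north_set m r P Q i"
  then obtain R where R: "R \<in> lattice_paths m r" "never_above R Q" "never_above P R"
    "is_ith_north_step R i j"
    by (auto simp: north_set_def paths_between_def)
  then have "height R \<in> band n p q"
    using never_above_height[OF R(1) Q] never_above_height[OF P R(1)]
    by (auto simp: band_def steps_height)
  moreover have "j \<in> ups n (height R)" "height R j = int i"
    using is_ith_north_step_iff[OF lattice_path_length[OF R(1)]] R(4) by auto
  ultimately show "\<exists>h\<in>band n p q. j \<in> ups n h \<and> h j = int i" by blast
next
  assume "\<exists>h\<in>band n p q. j \<in> ups n h \<and> h j = int i"
  then obtain h where h: "h \<in> band n p q" "j \<in> ups n h" "h j = int i" by blast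
  have "h n = int r" using bandD(3)[OF h(1)] q_end by simp
  then obtain R where R: "R \<in> lattice_paths m r" "\<And>k. k \<le> n \<Longrightarrow> height R k = h k"
    using height_surj bandD(1)[OF h(1)] by blast
  have "never_above R Q" "never_above P R"
    using never_above_height[OF R(1) Q] never_above_height[OF P R(1)] R(2) bandD(4,5)[OF h(1)] by auto
  moreover have "ups n (height R) = ups n h" by (rule ups_cong) (rule R(2))
  then have "is_ith_north_step R i j"
    using is_ith_north_step_iff[OF lattice_path_length[OF R(1)]] h R(2)[of j] by (auto simp: ups_def)
  ultimately show "j \<in> north_set m r P Q i"
    using R(1) by (auto simp: north_set_def paths_between_def)
qed

lemma ground_M: "ground M = {1..n}"
  by (simp add: lattice_path_matroid_def transversal_matroid_def)

text \<open>In a transversal, the elements of \<open>X\<close> in \<open>{Suc i..k}\<close> receive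
  distinct indices in \<open>{p i<..q k}\<close>; this is the interval condition for the greedy
  path. Conversely, the heights at the North steps of a path form a matching.\<close>

lemma indep_iff: "X \<in> indep_sets M \<longleftrightarrow> (\<exists>h\<in>band n p q. X \<subseteq> ups n h)"
proof
  assume "X \<in> indep_sets M"
  then obtain \<phi> where X: "X \<subseteq> {1..n}" and \<phi>: "inj_on \<phi> X" "\<forall>x\<in>X. x \<in> north_set m r P Q (\<phi> x)"
    by (auto simp: lattice_path_matroid_def transversal_matroid_def partial_transversal_def)
  have "int (card (X \<inter> {Suc i..k})) \<le> q k - p i" if ik: "i \<le> k" "k \<le> n" for i k
  proof -
    have "int (\<phi> x) \<in> {p i<..q k}" if x: "x \<in> X \<inter> {Suc i..k}" for x
    proof -
      obtain h where h: "h \<in> band n p q" "x \<in> ups n h" "h x = int (\<phi> x)"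
        using \<phi>(2) x north_set_iff by blast
      have "p i \<le> p (x - 1)" "q x \<le> q k"
        using x ik by (auto intro!: steps_between(1)[OF p_steps] steps_between(1)[OF q_steps])
      moreover have "p (x - 1) \<le> h (x - 1)" "h x \<le> q x"
        using x ik by (auto intro!: bandD(4,5)[OF h(1)])
      moreover have "h (x - 1) < h x" using h(2) by (simp add: ups_def)
      ultimately show ?thesis using h(3) by simp
    qed
    then have "card (X \<inter> {Suc i..k}) \<le> card {p i<..q k}"
      using \<phi>(1) by (intro card_inj_on_le[of "\<lambda>x. int (\<phi> x)"]) (auto simp: inj_on_def)
    \<comment> \<open>The cardinality of the interval is truncated at 0; this inequality makes it
      equal to \<open>q k - p i\<close>.\<close>
    moreover have "p i \<le> q k"
      using p_le_q[of k] steps_between(1)[OF p_steps, of i k] ik by simp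
    ultimately show ?thesis by simp
  qed
  then show "\<exists>h\<in>band n p q. X \<subseteq> ups n h"
    using greedy_band[of n p q X] p_steps ends X by blast
next
  assume "\<exists>h\<in>band n p q. X \<subseteq> ups n h"
  then obtain h where h: "h \<in> band n p q" "X \<subseteq> ups n h" by blast
  \<comment> \<open>North steps end at heights from 1 to \<open>r\<close>, so passing to
    \<open>nat\<close> loses nothing.\<close>
  have range: "0 < h x \<and> h x \<le> int r" if "x \<in> ups n h" for x
  proof -
    have "x - 1 \<le> n" "x \<le> n" "h (x - 1) < h x" using that by (auto simp: ups_def)
    then show ?thesis
      using steps_between(1)[OF bandD(1)[OF h(1)], of 0 "x - 1"]
        steps_between(1)[OF bandD(1)[OF h(1)], of x n] bandD(2,3)[OF h(1)] q_end
      by linarith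
  qed
  have "inj_on (\<lambda>x. nat (h x)) X"
  proof (rule inj_onI)
    fix x y assume xy: "x \<in> X" "y \<in> X" "nat (h x) = nat (h y)"
    then have "x \<in> ups n h" "y \<in> ups n h" using h(2) by auto
    moreover from this have "h x = h y" using range[of x] range[of y] xy(3) by linarith
    ultimately show "x = y" using inj_onD[OF ups_inj_on[OF bandD(1)[OF h(1)]]] by blast
  qed
  moreover have "(\<lambda>x. nat (h x)) ` X \<subseteq> {1..r}" using range h(2) by fastforce
  moreover have "x \<in> north_set m r P Q (nat (h x))" if "x \<in> X" for x
    using that h range[of x] by (auto simp: north_set_iff intro!: bexI[of _ h])
  moreover have "X \<subseteq> {1..n}" using h(2) by (auto simp: ups_def)
  ultimately show "X \<in> indep_sets M"
    unfolding lattice_path_matroid_def transversal_matroid_def partial_transversal_def by auto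
qed

lemma card_ups: "h \<in> band n p q \<Longrightarrow> card (ups n h) = r"
proof -
  assume h: "h \<in> band n p q"
  have "ups n h \<inter> {1..n} = ups n h" by (auto simp: ups_def)
  then show "card (ups n h) = r"
    using card_ups_Int[OF bandD(1)[OF h], of "{1..n}"] weight_initial[OF h, of n] bandD(3)[OF h] q_end
    by simp
qed

end

section \<open>Flacets\<close>

definition bases :: "'a matroid \<Rightarrow> 'a set set" where
  "bases M = {B \<in> indep_sets M. \<forall>X\<in>indep_sets M. B \<subseteq> X \<longrightarrow> X = B}"

text \<open>The usual matroid rank, written through bases so that it becomes the maximal weight over
  the band.\<close>

definition rank :: "'a matroid \<Rightarrow> 'a set \<Rightarrow> nat" where
  "rank M F = Max ((\<lambda>B. card (B \<inter> F)) ` bases M)"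

definition face :: "'a matroid \<Rightarrow> 'a set \<Rightarrow> 'a set set" where
  "face M F = {B \<in> bases M. card (B \<inter> F) = rank M F}"

text \<open>For a connected matroid these are the sets \<open>F\<close> with \<open>M|F\<close> and \<open>M/F\<close> connected, that is,
  the facets of the base polytope given by rank inequalities, where the facets lying in the
  hyperplanes \<open>x\<^sub>i = 0\<close> and \<open>x\<^sub>i = 1\<close> are left out.\<close>

definition flacet :: "'a matroid \<Rightarrow> 'a set \<Rightarrow> bool" where
  "flacet M F \<longleftrightarrow> F \<subseteq> ground M \<and> 2 \<le> card F \<and> 2 \<le> card (ground M - F) \<and>
     (\<forall>A\<subseteq>ground M. (\<forall>B\<in>face M F. \<forall>B'\<in>face M F. card (B \<inter> A) = card (B' \<inter> A))
        \<longrightarrow> A \<in> {{}, F, ground M - F, ground M})"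

context lattice_path_pair
begin

text \<open>Every path in the band has \<open>r\<close> North steps, so none of these sets lies
  properly inside another.\<close>

lemma bases_M: "bases M = ups n ` band n p q"
proof
  show "bases M \<subseteq> ups n ` band n p q"
  proof
    fix B assume B: "B \<in> bases M"
    then obtain h where h: "h \<in> band n p q" "B \<subseteq> ups n h" by (auto simp: bases_def indep_iff)
    then have "ups n h \<in> indep_sets M" using indep_iff by blast
    then have "ups n h = B" using B h by (simp add: bases_def)
    then show "B \<in> ups n ` band n p q" using h by blast
  qed
  show "ups n ` band n p q \<subseteq> bases M"
  proof
    fix B assume "B \<in> ups n ` band n p q"
    then obtain h where h: "h \<in> band n p q" "B = ups n h" by blast
    have "X = B" if X: "X \<in> indep_sets M" "B \<subseteq> X" for X
    proof -
      obtain g where g: "g \<in> band n p q" "X \<subseteq> ups n g" using X indep_iff by blast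
      have "finite (ups n g)" by (simp add: ups_def)
      then have "ups n h = ups n g"
        using g h X card_ups by (metis card_subset_eq order_trans)
      then show ?thesis using g X h by blast
    qed
    then show "B \<in> bases M" using h indep_iff by (auto simp: bases_def)
  qed
qed

lemma rank_M:
  assumes "F \<subseteq> {1..n}" "h \<in> extremal F"
  shows "int (rank M F) = weight F h"
proof -
  have h: "h \<in> band n p q" and max: "\<And>g. g \<in> band n p q \<Longrightarrow> weight F g \<le> weight F h"
    using assms(2) by (auto simp: extremal_def)
  have "rank M F = card (ups n h \<inter> F)"
    unfolding rank_def bases_M
  proof (rule Max_eqI)
    have "ups n ` band n p q \<subseteq> Pow {1..n}" by (auto simp: ups_def)
    then have "finite (ups n ` band n p q)" by (rule finite_subset) simp
    then show "finite ((\<lambda>B. card (B \<inter> F)) ` ups n ` band n p q)" by (rule finite_imageI)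
    show "card (ups n h \<inter> F) \<in> (\<lambda>B. card (B \<inter> F)) ` ups n ` band n p q" using h by blast
    fix y assume "y \<in> (\<lambda>B. card (B \<inter> F)) ` ups n ` band n p q"
    then obtain g where g: "g \<in> band n p q" "y = card (ups n g \<inter> F)" by blast
    then show "y \<le> card (ups n h \<inter> F)"
      using max[OF g(1)] card_ups_Int[OF bandD(1)[OF g(1)] assms(1)]
        card_ups_Int[OF bandD(1)[OF h] assms(1)] by simp
  qed
  then show ?thesis using card_ups_Int[OF bandD(1)[OF h] assms(1)] by simp
qed

text \<open>The weights are integers from 0 to \<open>n\<close>, so a maximum is attained; passing
  to \<open>nat\<close> keeps their order.\<close>

lemma extremal_nonempty: "F \<subseteq> {1..n} \<Longrightarrow> extremal F \<noteq> {}"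
proof -
  assume F: "F \<subseteq> {1..n}"
  have "weight F h \<le> int n" if "h \<in> band n p q" for h
  proof -
    have "card (ups n h \<inter> F) \<le> card {1..n}" by (rule card_mono) (auto simp: ups_def)
    then show ?thesis using card_ups_Int[OF bandD(1)[OF that] F] by simp
  qed
  moreover have "0 \<le> weight F h" if "h \<in> band n p q" for h
    using card_ups_Int[OF bandD(1)[OF that] F] by (metis of_nat_0_le_iff)
  ultimately have "\<exists>h. h \<in> band n p q \<and> (\<forall>g. g \<in> band n p q \<longrightarrow> nat (weight F g) \<le> nat (weight F h))"
    using q_in_band by (intro ex_has_greatest_nat[of _ q _ "Suc n"]) (auto simp: less_Suc_eq_le nat_le_iff)
  then obtain h where "h \<in> band n p q" "\<And>g. g \<in> band n p q \<Longrightarrow> nat (weight F g) \<le> nat (weight F h)"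
    by blast
  then have "h \<in> extremal F"
    using \<open>\<And>h. h \<in> band n p q \<Longrightarrow> 0 \<le> weight F h\<close> unfolding extremal_def by fastforce
  then show ?thesis by blast
qed

lemma face_M:
  assumes F: "F \<subseteq> {1..n}"
  shows "face M F = ups n ` extremal F"
proof -
  obtain e where e: "e \<in> extremal F" using extremal_nonempty[OF F] by blast
  have "card (ups n h \<inter> F) = rank M F \<longleftrightarrow> h \<in> extremal F" if h: "h \<in> band n p q" for h
  proof -
    have "card (ups n h \<inter> F) = rank M F \<longleftrightarrow> weight F h = weight F e"
      using card_ups_Int[OF bandD(1)[OF h] F] rank_M[OF F e] by linarith
    also have "\<dots> \<longleftrightarrow> h \<in> extremal F"
    proof
      show "h \<in> extremal F" if "weight F h = weight F e"
        using e h that by (simp add: extremal_def)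
      show "weight F h = weight F e" if "h \<in> extremal F"
        using e that by (intro antisym) (auto simp: extremal_def)
    qed
    finally show ?thesis .
  qed
  moreover have "extremal F \<subseteq> band n p q" by (auto simp: extremal_def)
  ultimately show ?thesis unfolding face_def bases_M by blast
qed

lemma flacet_iff_rigid: "flacet M F \<longleftrightarrow> rigid F"
proof (cases "F \<subseteq> {1..n}")
  case True
  have "card (ups n g \<inter> A) = card (ups n h \<inter> A) \<longleftrightarrow> weight A g = weight A h"
    if "A \<subseteq> {1..n}" "g \<in> extremal F" "h \<in> extremal F" for A g h
  proof -
    have "g \<in> band n p q" "h \<in> band n p q" using that by (auto simp: extremal_def)
    then show ?thesis
      using card_ups_Int[OF bandD(1) that(1), of g] card_ups_Int[OF bandD(1) that(1), of h] by linarith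
  qed
  note eq = this
  have "(\<forall>B\<in>face M F. \<forall>B'\<in>face M F. card (B \<inter> A) = card (B' \<inter> A)) \<longleftrightarrow>
      (\<forall>g\<in>extremal F. \<forall>h\<in>extremal F. weight A g = weight A h)" if A: "A \<subseteq> {1..n}" for A
  proof -
    have "(\<forall>B\<in>face M F. \<forall>B'\<in>face M F. card (B \<inter> A) = card (B' \<inter> A)) \<longleftrightarrow>
        (\<forall>g\<in>extremal F. \<forall>h\<in>extremal F. card (ups n g \<inter> A) = card (ups n h \<inter> A))"
      unfolding face_M[OF True] by (simp only: ball_simps)
    also have "\<dots> \<longleftrightarrow> (\<forall>g\<in>extremal F. \<forall>h\<in>extremal F. weight A g = weight A h)"
      by (intro ball_cong refl eq A)
    finally show ?thesis .
  qed
  then show ?thesis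
    unfolding flacet_def rigid_def ground_M by (intro conj_cong refl all_cong1 imp_cong) blast
qed (simp add: flacet_def rigid_def ground_M)

section \<open>Flacets of a lattice path matroid\<close>

definition initial_flacets :: "nat set set" where
  "initial_flacets = {{1..u} | u. corner n q u}"

text \<open>\<open>w\<close> is the size of the set and a corner position of the reversed
  path.\<close>

definition final_flacets :: "nat set set" where
  "final_flacets = {{Suc (n - w)..n} | w. corner n (reversed n p) w}"

lemma flacets_M:
  assumes "\<And>k. 0 < k \<Longrightarrow> k < n \<Longrightarrow> p k < q k"
  shows "{F. flacet M F} = initial_flacets \<union> final_flacets"
proof
  show "{F. flacet M F} \<subseteq> initial_flacets \<union> final_flacets"
    unfolding flacet_iff_rigid initial_flacets_def final_flacets_def
    by (auto elim!: rigid_is_corner_segment)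
  show "initial_flacets \<union> final_flacets \<subseteq> {F. flacet M F}"
    unfolding flacet_iff_rigid initial_flacets_def final_flacets_def
    using initial_corner_rigid[OF assms] final_corner_rigid[OF assms] by auto
qed

definition size_rank :: "nat set \<Rightarrow> nat \<times> int" where
  "size_rank F = (card F, int (rank M F))"

text \<open>\<open>q\<close> is extremal for \<open>{1..u}\<close>, so this set has rank
  \<open>q u\<close>.\<close>

lemma size_rank_initial: "size_rank ` initial_flacets = corner_data n q"
proof -
  have "size_rank {1..u} = (u, q u)" if "corner n q u" for u
    using that rank_M[of "{1..u}" q] extremal_initial(1)[of u] weight_initial[OF q_in_band, of u]
    by (auto simp: size_rank_def corner_def)
  then show ?thesis
    unfolding initial_flacets_def corner_data_def setcompr_eq_image image_image by (intro image_cong) auto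
qed

text \<open>\<open>p\<close> is extremal for the last \<open>w\<close> elements, so their rank is
  \<open>q n - p (n - w)\<close>, the height of the reversed path at \<open>w\<close>.\<close>

lemma size_rank_final: "size_rank ` final_flacets = corner_data n (reversed n p)"
proof -
  have "size_rank {Suc (n - w)..n} = (w, reversed n p w)" if "corner n (reversed n p) w" for w
    using that rank_M[of "{Suc (n - w)..n}" p] extremal_final(1)[of "n - w"]
      weight_final[OF p_in_band, of "n - w"] ends
    by (auto simp: size_rank_def corner_def reversed_def)
  then show ?thesis
    unfolding final_flacets_def corner_data_def setcompr_eq_image image_image by (intro image_cong) auto
qed

lemma initial_flacets_chain: "F \<in> initial_flacets \<Longrightarrow> G \<in> initial_flacets \<Longrightarrow> F \<subseteq> G \<or> G \<subseteq> F"
  unfolding initial_flacets_def by auto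

lemma final_flacets_chain: "F \<in> final_flacets \<Longrightarrow> G \<in> final_flacets \<Longrightarrow> F \<subseteq> G \<or> G \<subseteq> F"
  unfolding final_flacets_def by auto

lemma initial_final_incomparable:
  assumes "F \<in> initial_flacets" "G \<in> final_flacets"
  shows "\<not> (F \<subseteq> G \<or> G \<subseteq> F)"
proof -
  have "1 \<in> F" "n \<notin> F" using assms(1) by (auto simp: initial_flacets_def corner_def)
  moreover have "1 \<notin> G" "n \<in> G" using assms(2) by (auto simp: final_flacets_def corner_def)
  ultimately show ?thesis by blast
qed

text \<open>If the two bounding paths met after \<open>k\<close> steps, then independent subsets of \<open>{1..k}\<close> and of
  \<open>{k + 1..n}\<close> could be combined freely, so no circuit would contain both \<open>1\<close> and \<open>n\<close>.\<close>

lemma connected_strict: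
  assumes conn: "matroid_connected M" and k: "0 < k" "k < n"
  shows "p k < q k"
proof (rule ccontr)
  assume "\<not> p k < q k"
  then have pk: "p k = q k" using p_le_q[of k] k by simp
  have "1 \<in> ground M" "n \<in> ground M" "1 \<noteq> n" using k by (auto simp: ground_M)
  then obtain C where C: "circuit M C" "1 \<in> C" "n \<in> C"
    using conn unfolding matroid_connected_def by blast
  \<comment> \<open>Each half misses \<open>n\<close> or \<open>1\<close>, so it is a proper and
    hence independent part of the circuit.\<close>
  have "n \<notin> C \<inter> {1..k}" "1 \<notin> C \<inter> {Suc k..n}" using k by auto
  then have "C \<inter> {1..k} \<subset> C" "C \<inter> {Suc k..n} \<subset> C" using C(2,3) by blast+
  then have "C \<inter> {1..k} \<in> indep_sets M" "C \<inter> {Suc k..n} \<in> indep_sets M"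
    using C(1) by (auto simp: circuit_def)
  then obtain g h where g: "g \<in> band n p q" "C \<inter> {1..k} \<subseteq> ups n g"
    and h: "h \<in> band n p q" "C \<inter> {Suc k..n} \<subseteq> ups n h" by (auto simp: indep_iff)
  have gk: "g k = q k" "h k = q k"
    using bandD(4,5)[OF g(1), of k] bandD(4,5)[OF h(1), of k] k pk by auto
  \<comment> \<open>Both paths pass through the meeting point at \<open>k\<close>, so they can be
    spliced there.\<close>
  define f where "f i = (if i \<le> k then g i else h i)" for i
  have f': "f i = h i" if "k \<le> i" for i using that gk by (auto simp: f_def)
  have f: "f i = g i" if "i \<le> k" for i using that by (auto simp: f_def)
  have "f \<in> band n p q"
  proof -
    have "f i \<le> f (Suc i) \<and> f (Suc i) \<le> f i + 1" if i: "i < n" for i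
    proof (cases "i < k")
      case True
      then have "f i = g i" "f (Suc i) = g (Suc i)" by (simp_all add: f)
      then show ?thesis using bandD(6,7)[OF g(1) i] by simp
    next
      case False
      then have "f i = h i" "f (Suc i) = h (Suc i)" by (simp_all add: f')
      then show ?thesis using bandD(6,7)[OF h(1) i] by simp
    qed
    moreover have "p i \<le> f i \<and> f i \<le> q i" if "i \<le> n" for i
      using bandD(4,5)[OF g(1) that] bandD(4,5)[OF h(1) that] by (auto simp: f_def)
    moreover have "f 0 = 0" using bandD(2)[OF g(1)] by (simp add: f_def)
    ultimately show ?thesis unfolding band_def steps_def by blast
  qed
  moreover have "C \<subseteq> ups n f"
  proof
    fix x assume x: "x \<in> C"
    then have x': "x \<in> {1..n}" using C(1) x unfolding circuit_def ground_M by blast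
    show "x \<in> ups n f"
    proof (cases "x \<le> k")
      case True
      then have "x \<in> ups n g" "f x = g x" "f (x - 1) = g (x - 1)"
        using x x' g(2) by (auto simp: f)
      then show ?thesis by (simp add: ups_def)
    next
      case False
      then have "x \<in> ups n h" "f x = h x" "f (x - 1) = h (x - 1)"
        using x x' h(2) by (auto simp: f')
      then show ?thesis by (simp add: ups_def)
    qed
  qed
  ultimately have "C \<in> indep_sets M" using indep_iff by blast
  then show False using C(1) by (simp add: circuit_def)
qed

end

section \<open>Isomorphism invariance\<close>

locale matroid_iso =
  fixes M :: "'a matroid" and N :: "'b matroid" and f :: "'a \<Rightarrow> 'b"
  assumes bij: "bij_betw f (ground M) (ground N)"
    and indep: "\<And>X. X \<subseteq> ground M \<Longrightarrow> X \<in> indep_sets M \<longleftrightarrow> f ` X \<in> indep_sets N"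
    and indep_ground: "indep_sets M \<subseteq> Pow (ground M)" "indep_sets N \<subseteq> Pow (ground N)"
begin

lemma inj: "inj_on f (ground M)" and image_ground: "f ` ground M = ground N"
  using bij by (auto simp: bij_betw_def)

lemma surj_subset:
  assumes "Y \<subseteq> ground N"
  obtains X where "X \<subseteq> ground M" "Y = f ` X"
  using assms image_ground by (metis subset_imageE)

lemma image_subset_iff': "X \<subseteq> ground M \<Longrightarrow> Y \<subseteq> ground M \<Longrightarrow> f ` X \<subseteq> f ` Y \<longleftrightarrow> X \<subseteq> Y"
  using inj_on_image_mem_iff[OF inj, of _ Y] by blast

lemma image_eq_iff: "X \<subseteq> ground M \<Longrightarrow> Y \<subseteq> ground M \<Longrightarrow> f ` X = f ` Y \<longleftrightarrow> X = Y"
  using inj by (rule inj_on_image_eq_iff)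

lemma card_image_Int:
  assumes "X \<subseteq> ground M" "Y \<subseteq> ground M"
  shows "card (f ` X \<inter> f ` Y) = card (X \<inter> Y)"
proof -
  have "f ` X \<inter> f ` Y = f ` (X \<inter> Y)" using inj_on_image_Int[OF inj assms] by simp
  moreover have "inj_on f (X \<inter> Y)" using inj by (rule inj_on_subset) (use assms in blast)
  ultimately show ?thesis by (simp add: card_image)
qed

lemma card_image_subset: "X \<subseteq> ground M \<Longrightarrow> card (f ` X) = card X"
  using card_image_Int[of X X] by simp

lemma indep_sets_image: "indep_sets N = (`) f ` indep_sets M"
proof
  show "indep_sets N \<subseteq> (`) f ` indep_sets M"
  proof
    fix Y assume Y: "Y \<in> indep_sets N"
    then have "Y \<subseteq> ground N" using indep_ground(2) by blast
    then obtain X where X: "X \<subseteq> ground M" "Y = f ` X" by (rule surj_subset)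
    then show "Y \<in> (`) f ` indep_sets M" using Y indep[OF X(1)] by simp
  qed
  show "(`) f ` indep_sets M \<subseteq> indep_sets N"
  proof (rule image_subsetI)
    fix X assume X: "X \<in> indep_sets M"
    then have "X \<subseteq> ground M" using indep_ground(1) by blast
    then show "f ` X \<in> indep_sets N" using X indep by simp
  qed
qed

lemma bases_image: "bases N = (`) f ` bases M"
proof -
  have "f ` B \<in> bases N \<longleftrightarrow> B \<in> bases M" if B: "B \<subseteq> ground M" for B
  proof -
    have "(f ` B \<subseteq> f ` X \<longrightarrow> f ` X = f ` B) \<longleftrightarrow> (B \<subseteq> X \<longrightarrow> X = B)"
      if "X \<in> indep_sets M" for X
    proof -
      have "X \<subseteq> ground M" using that indep_ground(1) by blast
      then show ?thesis using image_subset_iff'[OF B] image_eq_iff[OF _ B] by simp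
    qed
    note eq = this
    have "(\<forall>Y\<in>indep_sets N. f ` B \<subseteq> Y \<longrightarrow> Y = f ` B) \<longleftrightarrow>
        (\<forall>X\<in>indep_sets M. f ` B \<subseteq> f ` X \<longrightarrow> f ` X = f ` B)"
      unfolding indep_sets_image by (simp only: ball_simps)
    also have "\<dots> \<longleftrightarrow> (\<forall>X\<in>indep_sets M. B \<subseteq> X \<longrightarrow> X = B)"
      by (intro ball_cong refl eq)
    finally show ?thesis
      unfolding bases_def mem_Collect_eq using indep[OF B] by (simp only:)
  qed
  note iff = this
  have "B \<in> (`) f ` bases M" if "B \<in> bases N" for B
  proof -
    have "B \<subseteq> ground N" using that indep_ground(2) by (auto simp: bases_def)
    then obtain X where X: "X \<subseteq> ground M" "B = f ` X" by (rule surj_subset)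
    then show ?thesis using iff[OF X(1)] that by simp
  qed
  moreover have "f ` B \<in> bases N" if "B \<in> bases M" for B
  proof -
    have "B \<subseteq> ground M" using that indep_ground(1) unfolding bases_def by blast
    then show ?thesis using that iff by simp
  qed
  ultimately show ?thesis by blast
qed

lemma bases_subset: "B \<in> bases M \<Longrightarrow> B \<subseteq> ground M"
  using indep_ground by (auto simp: bases_def)

lemma rank_image:
  assumes F: "F \<subseteq> ground M"
  shows "rank N (f ` F) = rank M F"
proof -
  have "(\<lambda>B. card (f ` B \<inter> f ` F)) ` bases M = (\<lambda>B. card (B \<inter> F)) ` bases M"
    by (intro image_cong refl card_image_Int[OF bases_subset F])
  then show ?thesis unfolding rank_def bases_image image_image by simp
qed

lemma face_image:
  assumes F: "F \<subseteq> ground M"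
  shows "face N (f ` F) = (`) f ` face M F"
proof -
  have "card (f ` B \<inter> f ` F) = card (B \<inter> F)" if "B \<in> bases M" for B
    using card_image_Int bases_subset[OF that] F by blast
  then show ?thesis unfolding face_def bases_image rank_image[OF F] by auto
qed

text \<open>Flacets are described by sizes of intersections with bases and by complements, all of
  which \<open>f\<close> preserves.\<close>

lemma flacet_image:
  assumes F: "F \<subseteq> ground M"
  shows "flacet N (f ` F) \<longleftrightarrow> flacet M F"
proof -
  have FG: "f ` (ground M - F) = ground N - f ` F"
    using inj_on_image_set_diff[OF inj Diff_subset F] image_ground by simp
  have 1: "f ` F \<subseteq> ground N" using F image_ground by blast
  have face_sub: "B \<in> face M F \<Longrightarrow> B \<subseteq> ground M" for B using bases_subset by (auto simp: face_def)
  have const: "(\<forall>B\<in>face N (f ` F). \<forall>B'\<in>face N (f ` F). card (B \<inter> f ` A) = card (B' \<inter> f ` A))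
      \<longleftrightarrow> (\<forall>B\<in>face M F. \<forall>B'\<in>face M F. card (B \<inter> A) = card (B' \<inter> A))" if A: "A \<subseteq> ground M" for A
    unfolding face_image[OF F] using card_image_Int[OF face_sub A] by simp
  have mem: "f ` A \<in> {{}, f ` F, ground N - f ` F, ground N} \<longleftrightarrow> A \<in> {{}, F, ground M - F, ground M}"
    if A: "A \<subseteq> ground M" for A
    by (simp only: insert_iff empty_iff image_is_empty image_eq_iff[OF A F]
      image_eq_iff[OF A Diff_subset, of F, unfolded FG] image_eq_iff[OF A subset_refl, unfolded image_ground])
  \<comment> \<open>Every subset of \<open>ground N\<close> is an image, so the quantifier moves to
    \<open>ground M\<close>.\<close>
  have "(\<forall>A\<subseteq>ground N. (\<forall>B\<in>face N (f ` F). \<forall>B'\<in>face N (f ` F). card (B \<inter> A) = card (B' \<inter> A))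
        \<longrightarrow> A \<in> {{}, f ` F, ground N - f ` F, ground N})
    \<longleftrightarrow> (\<forall>A\<subseteq>ground M. (\<forall>B\<in>face N (f ` F). \<forall>B'\<in>face N (f ` F). card (B \<inter> f ` A) = card (B' \<inter> f ` A))
        \<longrightarrow> f ` A \<in> {{}, f ` F, ground N - f ` F, ground N})"
    unfolding image_ground[symmetric] by (rule all_subset_image)
  also have "\<dots> \<longleftrightarrow> (\<forall>A\<subseteq>ground M. (\<forall>B\<in>face M F. \<forall>B'\<in>face M F. card (B \<inter> A) = card (B' \<inter> A))
        \<longrightarrow> A \<in> {{}, F, ground M - F, ground M})"
    by (intro all_cong1 imp_cong refl) (rule const, assumption | rule mem, assumption)+
  finally show ?thesis
    unfolding flacet_def using 1 F card_image_subset[OF F] card_image_subset[of "ground M - F"] FG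
    by simp
qed

lemma flacets_image: "{F. flacet N F} = (`) f ` {F. flacet M F}"
proof (intro equalityI subsetI)
  fix F assume "F \<in> {F. flacet N F}"
  then have F: "flacet N F" by simp
  then have "F \<subseteq> ground N" by (simp add: flacet_def)
  then obtain X where X: "X \<subseteq> ground M" "F = f ` X" by (rule surj_subset)
  then have "flacet M X" using flacet_image[OF X(1)] F by simp
  then show "F \<in> (`) f ` {F. flacet M F}" using X(2) by (intro image_eqI[of F _ X]) simp_all
next
  fix F assume "F \<in> (`) f ` {F. flacet M F}"
  then obtain X where X: "F = f ` X" "flacet M X" by auto
  then have "X \<subseteq> ground M" by (simp add: flacet_def)
  then show "F \<in> {F. flacet N F}" using flacet_image X by simp
qed

lemma circuit_image:
  assumes "C \<subseteq> ground M"
  shows "circuit N (f ` C) \<longleftrightarrow> circuit M C"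
proof -
  have "(\<forall>D. D \<subset> f ` C \<longrightarrow> D \<in> indep_sets N) \<longleftrightarrow> (\<forall>D. D \<subset> C \<longrightarrow> D \<in> indep_sets M)"
  proof (intro iffI allI impI)
    fix D assume *: "\<forall>D. D \<subset> f ` C \<longrightarrow> D \<in> indep_sets N" and D: "D \<subset> C"
    then have DM: "D \<subseteq> ground M" using assms by blast
    have "f ` D \<subset> f ` C"
      using D image_subset_iff'[OF DM assms] image_eq_iff[OF DM assms] by (simp add: psubset_eq)
    then show "D \<in> indep_sets M" using * indep[OF DM] by simp
  next
    fix D assume *: "\<forall>D. D \<subset> C \<longrightarrow> D \<in> indep_sets M" and D: "D \<subset> f ` C"
    then obtain D' where D': "D' \<subseteq> C" "D = f ` D'" by (metis psubset_imp_subset subset_imageE)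
    then have "D' \<subset> C" using D by blast
    moreover have "D' \<subseteq> ground M" using D'(1) assms by blast
    ultimately show "D \<in> indep_sets N" using * D'(2) indep[of D'] by simp
  qed
  moreover have "f ` C \<subseteq> ground N" using assms image_ground by blast
  ultimately show ?thesis using indep[OF assms] assms by (simp add: circuit_def)
qed

text \<open>Needed to separate the second pair of bounding paths strictly as well.\<close>

lemma connected_pullback:
  assumes "matroid_connected N"
  shows "matroid_connected M"
  unfolding matroid_connected_def
proof (intro ballI impI)
  fix x y assume xy: "x \<in> ground M" "y \<in> ground M" "x \<noteq> y"
  then have "f x \<in> ground N" "f y \<in> ground N" "f x \<noteq> f y"
    using image_ground inj by (auto dest: inj_onD)
  then obtain C' where C': "circuit N C'" "f x \<in> C'" "f y \<in> C'"
    using assms unfolding matroid_connected_def by blast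
  then have "C' \<subseteq> ground N" unfolding circuit_def by blast
  then obtain C where C: "C \<subseteq> ground M" "C' = f ` C" by (rule surj_subset)
  then have "x \<in> C" "y \<in> C" using C' inj_on_image_mem_iff[OF inj _ C(1)] xy by simp_all
  then show "\<exists>C. circuit M C \<and> x \<in> C \<and> y \<in> C" using C C'(1) circuit_image[OF C(1)] by blast
qed

end

text \<open>Two sets of pairwise comparable elements with no comparabilities across are the connected
  components of the comparability relation, so an isomorphism permutes them.\<close>

lemma two_chains:
  fixes g :: "'a \<Rightarrow> 'b"
  assumes image: "g ` (I \<union> J) = I' \<union> J'"
    and cmp: "\<And>x y. x \<in> I \<union> J \<Longrightarrow> y \<in> I \<union> J \<Longrightarrow> c' (g x) (g y) \<longleftrightarrow> c x y"
    and chains: "\<And>x y. x \<in> I \<Longrightarrow> y \<in> I \<Longrightarrow> c x y" "\<And>x y. x \<in> J \<Longrightarrow> y \<in> J \<Longrightarrow> c x y"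
      "\<And>x y. x \<in> I' \<Longrightarrow> y \<in> I' \<Longrightarrow> c' x y" "\<And>x y. x \<in> J' \<Longrightarrow> y \<in> J' \<Longrightarrow> c' x y"
    and cross: "\<And>x y. x \<in> I \<Longrightarrow> y \<in> J \<Longrightarrow> \<not> c x y" "\<And>x y. x \<in> I' \<Longrightarrow> y \<in> J' \<Longrightarrow> \<not> c' x y"
      "\<And>x y. c x y \<Longrightarrow> c y x" "\<And>x y. c' x y \<Longrightarrow> c' y x"
  shows "g ` I = I' \<and> g ` J = J' \<or> g ` I = J' \<and> g ` J = I'"
proof -
  have disj: "I' \<inter> J' = {}" using chains(3) cross(2) by blast
  have mem: "g x \<in> I' \<union> J'" if "x \<in> I \<union> J" for x using image that by blast
  have same: "g x \<in> I' \<longleftrightarrow> g y \<in> I'" if "x \<in> I \<union> J" "y \<in> I \<union> J" "c x y" for x y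
    using cmp[OF that(1,2)] mem[OF that(1)] mem[OF that(2)] that(3) cross(2,4) by blast
  have diff: "g x \<in> I' \<longleftrightarrow> g y \<notin> I'" if "x \<in> I" "y \<in> J" for x y
  proof -
    have "\<not> c' (g x) (g y)" "g x \<in> I' \<union> J'" "g y \<in> I' \<union> J'"
      using cmp[of x y] mem[of x] mem[of y] that cross(1)[OF that] by auto
    then show ?thesis using chains(3,4)[of "g x" "g y"] disj by blast
  qed
  have "g ` I \<subseteq> I' \<and> g ` J \<subseteq> J' \<or> g ` I \<subseteq> J' \<and> g ` J \<subseteq> I'"
  \<comment> \<open>One witness fixes the orientation of both chains. The absence of witnesses is
    already the crossed case, so empty chains are covered too.\<close>
  proof (cases "(\<exists>x\<in>I. g x \<in> I') \<or> (\<exists>x\<in>J. g x \<notin> I')")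
    case True
    then have "(\<forall>x\<in>I. g x \<in> I') \<and> (\<forall>x\<in>J. g x \<notin> I')"
    proof
      assume "\<exists>x\<in>I. g x \<in> I'"
      then obtain x where "x \<in> I" "g x \<in> I'" by blast
      then show ?thesis using same[of x] chains(1)[of x] diff[of x] by auto
    next
      assume "\<exists>x\<in>J. g x \<notin> I'"
      then obtain x where "x \<in> J" "g x \<notin> I'" by blast
      then show ?thesis using same[of x] chains(2)[of x] diff[of _ x] by auto
    qed
    then show ?thesis using mem by auto
  next
    case False
    then show ?thesis using mem by auto
  qed
  \<comment> \<open>Containments become equalities because the images cover the disjoint
    union.\<close>
  moreover have "U = A \<and> V = B"
    if "U \<union> V = A \<union> B" "A \<inter> B = {}" "U \<subseteq> A" "V \<subseteq> B" for U V A B :: "'b set"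
    using that by blast
  note split = this
  have "g ` I \<union> g ` J = I' \<union> J'" "g ` I \<union> g ` J = J' \<union> I'" "J' \<inter> I' = {}"
    using image disj by (simp_all add: image_Un Un_commute Int_commute)
  ultimately show ?thesis
    using split[of "g ` I" "g ` J" I' J'] split[of "g ` I" "g ` J" J' I'] disj by argo
qed

section \<open>Recovering the bounding paths from the matroid\<close>

theorem theorem5p6:
  fixes m r m' r' :: nat
    and P Q P' Q' :: "lattice_step list"
  assumes "P \<in> lattice_paths m r" and "Q \<in> lattice_paths m r" and "never_above P Q"
    and "matroid_connected (lattice_path_matroid m r P Q)"
    and "P' \<in> lattice_paths m' r'" and "Q' \<in> lattice_paths m' r'" and "never_above P' Q'"
    and "matroid_isomorphic (lattice_path_matroid m' r' P' Q') (lattice_path_matroid m r P Q)"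
  shows "(P', Q') = (P, Q) \<or> (P', Q') = (rev Q, rev P)"
proof -
  interpret L: lattice_path_pair m r P Q using assms by unfold_locales
  interpret L': lattice_path_pair m' r' P' Q' using assms by unfold_locales
  obtain f where "bij_betw f (ground L'.M) (ground L.M)"
    "\<And>X. X \<subseteq> ground L'.M \<Longrightarrow> X \<in> indep_sets L'.M \<longleftrightarrow> f ` X \<in> indep_sets L.M"
    using assms(8) unfolding matroid_isomorphic_def by blast
  then interpret iso: matroid_iso L'.M L.M f
    by unfold_locales (auto simp: lattice_path_matroid_def transversal_matroid_def)
  have n: "m' + r' = m + r"
    using bij_betw_same_card[OF iso.bij] by (simp add: L.ground_M L'.ground_M)
  \<comment> \<open>\<open>f\<close> maps bases, of size \<open>r'\<close>, to bases, of size
    \<open>r\<close>.\<close>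
  have r: "r' = r"
  proof -
    have "ups (m' + r') (height Q') \<in> bases L'.M" using L'.q_in_band by (auto simp: L'.bases_M)
    then have B: "f ` ups (m' + r') (height Q') \<in> bases L.M" "ups (m' + r') (height Q') \<subseteq> ground L'.M"
      using iso.bases_image iso.bases_subset by auto
    then obtain h where "h \<in> band (m + r) (height P) (height Q)"
      "f ` ups (m' + r') (height Q') = ups (m + r) h" by (auto simp: L.bases_M)
    then show ?thesis
      using L.card_ups L'.card_ups[OF L'.q_in_band] iso.card_image_subset[OF B(2)] by simp
  qed
  define n where "n = m + r"
  have n_eq: "m + r = n" "m' + r' = n" using n by (simp_all add: n_def)
  have strict: "height P k < height Q k" if "0 < k" "k < n" for k
    using L.connected_strict assms(4) that by (simp add: n_def)
  have strict': "height P' k < height Q' k" if "0 < k" "k < n" for k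
    using L'.connected_strict iso.connected_pullback assms(4) that n_eq by simp
  have flacets: "{F. flacet L.M F} = L.initial_flacets \<union> L.final_flacets"
    using strict by (intro L.flacets_M) (simp add: n_eq)
  have flacets': "{F. flacet L'.M F} = L'.initial_flacets \<union> L'.final_flacets"
    using strict' by (intro L'.flacets_M) (simp add: n_eq)
  have ground: "F \<subseteq> ground L'.M" if "F \<in> L'.initial_flacets \<union> L'.final_flacets" for F
    using that unfolding flacets'[symmetric] flacet_def by blast
  have image: "(`) f ` (L'.initial_flacets \<union> L'.final_flacets) = L.initial_flacets \<union> L.final_flacets"
    unfolding flacets[symmetric] flacets'[symmetric] iso.flacets_image ..
  have chains: "(`) f ` L'.initial_flacets = L.initial_flacets \<and> (`) f ` L'.final_flacets = L.final_flacets
    \<or> (`) f ` L'.initial_flacets = L.final_flacets \<and> (`) f ` L'.final_flacets = L.initial_flacets"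
  proof (rule two_chains[where c = "\<lambda>F G. F \<subseteq> G \<or> G \<subseteq> F" and c' = "\<lambda>F G. F \<subseteq> G \<or> G \<subseteq> F", OF image])
    show "f ` F \<subseteq> f ` G \<or> f ` G \<subseteq> f ` F \<longleftrightarrow> F \<subseteq> G \<or> G \<subseteq> F"
      if "F \<in> L'.initial_flacets \<union> L'.final_flacets" "G \<in> L'.initial_flacets \<union> L'.final_flacets" for F G
      using iso.image_subset_iff' ground[OF that(1)] ground[OF that(2)] by simp
  qed (erule (1) L.initial_flacets_chain L.final_flacets_chain L'.initial_flacets_chain
    L'.final_flacets_chain L.initial_final_incomparable L'.initial_final_incomparable
    | erule disj_commute[THEN iffD1])+
  \<comment> \<open>Carries the corner data of one pair of paths over to the other.\<close>
  have size_rank: "L.size_rank ` (`) f ` \<F> = L'.size_rank ` \<F>"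
    if "\<F> \<subseteq> L'.initial_flacets \<union> L'.final_flacets" for \<F>
  proof -
    have "L.size_rank (f ` F) = L'.size_rank F" if "F \<in> \<F>" for F
    proof -
      have "F \<subseteq> ground L'.M" using that \<open>\<F> \<subseteq> _\<close> ground by blast
      from iso.rank_image[OF this] iso.card_image_subset[OF this] show ?thesis
        by (simp add: L.size_rank_def L'.size_rank_def)
    qed
    then show ?thesis unfolding image_image by (rule image_cong[OF refl])
  qed
  let ?p = "height P" and ?q = "height Q" and ?p' = "height P'" and ?q' = "height Q'"
  have size: "length P = n" "length Q = n" "length P' = n" "length Q' = n"
    using assms(1,2,5,6)[THEN lattice_path_length] n_eq by simp_all
  have top: "?p n = int r" "?q n = int r" "?p' n = int r" "?q' n = int r"
    using assms(1,2,5,6)[THEN height_end, of n] n_eq r by simp_all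
  have rev_top: "reversed n h n = h n" if "h 0 = 0" for h using that by (simp add: reversed_def)
  have zero: "height w 0 = 0" for w by (simp add: height_def)
  have data: "corner_data n ?q' = L'.size_rank ` L'.initial_flacets"
    "corner_data n (reversed n ?p') = L'.size_rank ` L'.final_flacets"
    "corner_data n ?q = L.size_rank ` L.initial_flacets"
    "corner_data n (reversed n ?p) = L.size_rank ` L.final_flacets"
    using L.size_rank_initial L.size_rank_final L'.size_rank_initial L'.size_rank_final
    by (simp_all add: n_eq)
  from chains show ?thesis
  proof
    assume *: "(`) f ` L'.initial_flacets = L.initial_flacets \<and> (`) f ` L'.final_flacets = L.final_flacets"
    have data_eq: "corner_data n ?q' = corner_data n ?q"
      unfolding data using * size_rank[of L'.initial_flacets] by simp
    have eq: "?q' k = ?q k" if "k \<le> n" for k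
      by (rule corner_data_determines[OF steps_height steps_height _ data_eq that]) (simp add: top rev_top zero)
    then have "Q' = Q" by (intro height_inject[OF size(4,2)])
    have data_eq: "corner_data n (reversed n ?p') = corner_data n (reversed n ?p)"
      unfolding data using * size_rank[of L'.final_flacets] by simp
    have eq: "reversed n ?p' k = reversed n ?p k" if "k \<le> n" for k
      by (rule corner_data_determines[OF steps_reversed[OF steps_height] steps_reversed[OF steps_height] _ data_eq that]) (simp add: top rev_top zero)
    \<comment> \<open>Undo the reversal by evaluating at \<open>n - k\<close>; both paths end at
      height \<open>r\<close>.\<close>
    have "?p' k = ?p k" if "k \<le> n" for k
      using eq[of "n - k"] that by (simp add: reversed_def top)
    then have "P' = P" by (intro height_inject[OF size(3,1)])
    with \<open>Q' = Q\<close> show ?thesis by simp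
  next
    \<comment> \<open>The families are exchanged: \<open>Q'\<close> has the corners of the reversed
      \<open>P\<close>, and the reversed \<open>P'\<close> those of \<open>Q\<close>.\<close>
    assume *: "(`) f ` L'.initial_flacets = L.final_flacets \<and> (`) f ` L'.final_flacets = L.initial_flacets"
    have data_eq: "corner_data n ?q' = corner_data n (reversed n ?p)"
      unfolding data using * size_rank[of L'.initial_flacets] by simp
    have eq: "?q' k = reversed n ?p k" if "k \<le> n" for k
      by (rule corner_data_determines[OF steps_reversed[OF steps_height] steps_height _ data_eq that]) (simp add: top rev_top zero)
    then have "Q' = rev P"
      by (intro height_inject[where n = n]) (simp_all add: size height_rev)
    have data_eq: "corner_data n (reversed n ?p') = corner_data n ?q"
      unfolding data using * size_rank[of L'.final_flacets] by simp
    have eq: "reversed n ?p' k = ?q k" if "k \<le> n" for k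
      by (rule corner_data_determines[OF steps_height steps_reversed[OF steps_height] _ data_eq that]) (simp add: top rev_top zero)
    have "?p' k = reversed n ?q k" if "k \<le> n" for k
      using eq[of "n - k"] that by (simp add: reversed_def top)
    then have "P' = rev Q"
      by (intro height_inject[where n = n]) (simp_all add: size height_rev)
    with \<open>Q' = rev P\<close> show ?thesis by simp
  qed
qed

end
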